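(* Let $E(H,K)\equiv e\to H\xrightarrow{i} G\xrightarrow{\beta} K\to e$ be a center extension of multiplicative Lie algebras which splits. Then the exact sequences of groups $$e\to\mathrm{Aut}^{H,K}(G)\xrightarrow{\,i\,}\mathrm{Aut}_H^K(G)\xrightarrow{\Pi_1}C_1^{L^*}\to e,\qquad e\to\mathrm{Aut}^{H,K}(G)\xrightarrow{\,i\,}\mathrm{Aut}^H(G)\xrightarrow{\Pi_2}C_2^{L^*}\to e$$ also split. Moreover, if in addition $E(H,K)$ is a central extension, i.e. $H\subseteq Z(G)\cap LZ(G)$, then the exact sequence of groups $$e\to Z^1_{ML(\Gamma)}(K,H)\xrightarrow{\,i\,}\mathrm{Aut}_H(G)\xrightarrow{\Pi}C^{L^*}\to e$$ splits.
   Context: A multiplicative Lie algebra is a triple $(G,\cdot,\star)$ where $(G,\cdot)$ is a (possibly non-abelian) group with identity $e$ and $\star$ is a binary operation such that for all $x,y,z\in G$, writing ${}^zx=zxz^{-1}$: $x\star x=e$; $x\star(yz)=(x\star y)\cdot{}^y(x\star z)$; $(xy)\star z={}^x(y\star z)\cdot(x\star z)$; $((x\star y)\star{}^yz)((y\star z)\star{}^zx)((z\star x)\star{}^xy)=e$; ${}^z(x\star y)={}^zx\star{}^zy$. Homomorphisms preserve both operations, and $\mathrm{Aut}$ denotes the group of automorphisms of a multiplicative Lie algebra. $Z(G)$ is the group center and $LZ(G)=\{x\in G:x\star y=e\ \forall y\in G\}$. A center extension $E(H,K)\equiv e\to H\xrightarrow{i} G\xrightarrow{\beta}K\to e$ is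 a short exact sequence of multiplicative Lie algebras in which $H$ (identified with $i(H)=\ker\beta$) is contained in $Z(G)$ and $a\star b=e$ for all $a,b\in H$. $H$ is an ideal of $G$, so $g\star a\in H$ for $g\in G$, $a\in H$. A transversal is a map $t:K\to G$ with $\beta(t(x))=x$ for all $x\in K$ and $t(e)=e$; the extension splits if some transversal is a homomorphism of multiplicative Lie algebras. A short exact sequence of groups $e\to A\to B\xrightarrow{p}C\to e$ splits if there is a group homomorphism $\delta:C\to B$ with $p\circ\delta=\mathrm{id}_C$. The maps associated with a transversal $t$ are $f(x,y)=t(x)t(y)t(xy)^{-1}\in H$, $h(x,y)=(t(x)\star t(y))\,t(x\star y)^{-1}\in H$ and $\Gamma_x\in\mathrm{End}(H)$, $\Gamma_x(a)=t(x)\star a$, for $x,y\in K$, $a\in H$. A pair $(u,v)$ of maps $K\times K\to H$ (more precisely, the multiplicative center 2-cocycle $(u,v,\Gamma)$) has trivial class in the second cohomology $H^2_{ML(\Gamma)}(K,H)=Z^2_{ML(\Gamma)}(K,H)/B^2_{ML(\Gamma)}(K,H)$ iff it is a 2-coboundary, i.e. there is $\lambda:K\to H$ with $\lambda(e)=e$, $u(x,y)=\lambda(x)\lambda(y)\lambda(xy)^{-1}$ and $v(x,y)=\Gamma_x(\lambda(y))\Gamma_y(\lambda(x)^{-1})\lambda(x\star y)^{-1}$ for all $x,y\in K$. $Z^1_{ML(\Gamma)}(K,H)$ is the abelian group (pointwise operation) of maps $\nu:K\to H$ with $\nu(xy)=\nu(x)\nu(y)$ and $\nu(x\star y)=\Gamma_x(\nu(y))\Gamma_y(\nu(x)^{-1})$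 for all $x,y\in K$. $\mathrm{Aut}_H(G)=\{\phi\in\mathrm{Aut}(G):\phi(H)=H\}$; $\mathrm{Aut}^H(G)=\{\phi\in\mathrm{Aut}(G):\phi(a)=a\ \forall a\in H\}$; $\mathrm{Aut}^{H,K}(G)=\{\phi\in\mathrm{Aut}^H(G):\phi(g)g^{-1}\in H\ \forall g\in G\}$; $\mathrm{Aut}_H^K(G)=\{\phi\in\mathrm{Aut}_H(G):\phi(g)g^{-1}\in H\ \forall g\in G\}$. In the first two sequences $i$ is inclusion; in the third, $i(\nu)$ is the automorphism $a\,t(x)\mapsto a\,\nu(x)\,t(x)$ ($a\in H$, $x\in K$). For $\phi\in \mathrm{Aut}_H(G)$ put $\alpha=\phi|_H$ and $\eta(x)=\beta(\phi(t(x)))$; then $\Pi_1(\phi)=\alpha$, $\Pi_2(\phi)=\eta$, $\Pi(\phi)=(\alpha,\eta)$ on the respective groups. $C_1^{L^*}$ is the set of $\alpha\in\mathrm{Aut}(H)$ with $\alpha\Gamma_x=\Gamma_x\alpha$ for all $x\in K$ for which $\chi_1(\alpha)$ is trivial, where $\chi_1(\alpha)$ is the class of the pair $f(x,y)\alpha(f(x,y))^{-1}$, $h(x,y)\alpha(h(x,y))^{-1}$. $C_2^{L^*}$ is the set of $\eta\in\mathrm{Aut}(K)$ with $\Gamma_{\eta(x)}=\Gamma_x$ for all $x\in K$ for which $\chi_2(\eta)$ is trivial, where $\chi_2(\eta)$ is the class of the pair $f(\eta(x),\eta(y))f(x,y)^{-1}$, $h(\eta(x),\eta(y))h(x,y)^{-1}$.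 In the central case ($\Gamma_x(a)=e$ for all $x,a$), $C^{L^*}$ is the set of $(\alpha,\eta)\in\mathrm{Aut}(H)\times\mathrm{Aut}(K)$ for which $\chi(\alpha,\eta)$ is trivial, where $\chi(\alpha,\eta)$ is the class of the pair $f(\eta(x),\eta(y))\alpha(f(x,y))^{-1}$, $h(\eta(x),\eta(y))\alpha(h(x,y))^{-1}$. (All classes are independent of the transversal.) *)

theory Defs
  imports "HOL-Algebra.Bij" "HOL-Algebra.Coset"
begin

section \<open>Multiplicative Lie algebras\<close>

record 'a mla = "'a monoid" +
  star :: "['a, 'a] \<Rightarrow> 'a" (infixl "\<star>\<index>" 70)

definition conj_by :: "('a, 'm) monoid_scheme \<Rightarrow> 'a \<Rightarrow> 'a \<Rightarrow> 'a"
  where "conj_by G z x = z \<otimes>\<^bsub>G\<^esub> x \<otimes>\<^bsub>G\<^esub> inv\<^bsub>G\<^esub> z"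

locale mult_lie_algebra = group G for G :: "('a, 'm) mla_scheme" (structure) +
  assumes star_closed: "\<lbrakk>x \<in> carrier G; y \<in> carrier G\<rbrakk> \<Longrightarrow> x \<star> y \<in> carrier G"
    and star_self: "x \<in> carrier G \<Longrightarrow> x \<star> x = \<one>"
    and star_mult_right: "\<lbrakk>x \<in> carrier G; y \<in> carrier G; z \<in> carrier G\<rbrakk>
        \<Longrightarrow> x \<star> (y \<otimes> z) = (x \<star> y) \<otimes> conj_by G y (x \<star> z)"
    and star_mult_left: "\<lbrakk>x \<in> carrier G; y \<in> carrier G; z \<in> carrier G\<rbrakk>
        \<Longrightarrow> (x \<otimes> y) \<star> z = conj_by G x (y \<star> z) \<otimes> (x \<star> z)"
    and star_jacobi: "\<lbrakk>x \<in> carrier G; y \<in> carrier G; z \<in> carrier G\<rbrakk>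
        \<Longrightarrow> ((x \<star> y) \<star> conj_by G y z) \<otimes> ((y \<star> z) \<star> conj_by G z x)
            \<otimes> ((z \<star> x) \<star> conj_by G x y) = \<one>"
    and star_conj: "\<lbrakk>x \<in> carrier G; y \<in> carrier G; z \<in> carrier G\<rbrakk>
        \<Longrightarrow> conj_by G z (x \<star> y) = conj_by G z x \<star> conj_by G z y"

definition mla_hom :: "('a, 'm) mla_scheme \<Rightarrow> ('b, 'n) mla_scheme \<Rightarrow> ('a \<Rightarrow> 'b) set"
  where "mla_hom G K = {\<phi> \<in> hom G K.
    \<forall>x \<in> carrier G. \<forall>y \<in> carrier G. \<phi> (x \<star>\<^bsub>G\<^esub> y) = \<phi> x \<star>\<^bsub>K\<^esub> \<phi> y}"

text \<open>As in \<^theory>\<open>HOL-Algebra.Bij\<close>, automorphisms are extensional functions on the carrier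
  and the group operation is composition.\<close>

definition mla_auto :: "('a, 'm) mla_scheme \<Rightarrow> ('a \<Rightarrow> 'a) set"
  where "mla_auto G = mla_hom G G \<inter> Bij (carrier G)"

definition mla_AutoGroup :: "('a, 'm) mla_scheme \<Rightarrow> ('a \<Rightarrow> 'a) monoid"
  where "mla_AutoGroup G = BijGroup (carrier G) \<lparr>carrier := mla_auto G\<rparr>"

definition group_center :: "('a, 'm) monoid_scheme \<Rightarrow> 'a set"
  where "group_center G = {x \<in> carrier G. \<forall>y \<in> carrier G. x \<otimes>\<^bsub>G\<^esub> y = y \<otimes>\<^bsub>G\<^esub> x}"

definition lie_center :: "('a, 'm) mla_scheme \<Rightarrow> 'a set"
  where "lie_center G = {x \<in> carrier G. \<forall>y \<in> carrier G. x \<star>\<^bsub>G\<^esub> y = \<one>\<^bsub>G\<^esub>}"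


section \<open>Short exact sequences and center extensions\<close>

text \<open>The notion in \<open>HOL-Algebra.Exact_Sequence\<close> forces all groups of a sequence to have
  the same element type, which is too restrictive here.\<close>

definition short_exact ::
  "('a, 'l) monoid_scheme \<Rightarrow> ('b, 'm) monoid_scheme \<Rightarrow> ('c, 'n) monoid_scheme
    \<Rightarrow> ('a \<Rightarrow> 'b) \<Rightarrow> ('b \<Rightarrow> 'c) \<Rightarrow> bool"
  where "short_exact A B C j p \<longleftrightarrow> group A \<and> group B \<and> group C
    \<and> j \<in> mon A B \<and> p \<in> epi B C \<and> j ` carrier A = kernel B C p"

definition group_split ::
  "('b, 'm) monoid_scheme \<Rightarrow> ('c, 'n) monoid_scheme \<Rightarrow> ('b \<Rightarrow> 'c) \<Rightarrow> bool"
  where "group_split B C p \<longleftrightarrow> (\<exists>\<delta> \<in> hom C B. \<forall>c \<in> carrier C. p (\<delta> c) = c)"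

locale center_extension =
  H: mult_lie_algebra H + G: mult_lie_algebra G + K: mult_lie_algebra K
  for H :: "('h, 'l) mla_scheme" and \<iota> :: "'h \<Rightarrow> 'g" and G :: "('g, 'm) mla_scheme"
    and \<beta> :: "'g \<Rightarrow> 'k" and K :: "('k, 'n) mla_scheme" +
  assumes incl_hom: "\<iota> \<in> mla_hom H G"
    and proj_hom: "\<beta> \<in> mla_hom G K"
    and exact: "short_exact H G K \<iota> \<beta>"
    and image_in_center: "\<iota> ` carrier H \<subseteq> group_center G"
    and star_trivial: "\<lbrakk>a \<in> carrier H; b \<in> carrier H\<rbrakk> \<Longrightarrow> a \<star>\<^bsub>H\<^esub> b = \<one>\<^bsub>H\<^esub>"

definition transversal ::
  "('g, 'm) mla_scheme \<Rightarrow> ('g \<Rightarrow> 'k) \<Rightarrow> ('k, 'n) mla_scheme \<Rightarrow> ('k \<Rightarrow> 'g) \<Rightarrow> bool"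
  where "transversal G \<beta> K t \<longleftrightarrow> t \<in> carrier K \<rightarrow> carrier G
    \<and> (\<forall>x \<in> carrier K. \<beta> (t x) = x) \<and> t \<one>\<^bsub>K\<^esub> = \<one>\<^bsub>G\<^esub>"

definition extension_splits ::
  "('g, 'm) mla_scheme \<Rightarrow> ('g \<Rightarrow> 'k) \<Rightarrow> ('k, 'n) mla_scheme \<Rightarrow> bool"
  where "extension_splits G \<beta> K \<longleftrightarrow> (\<exists>s. transversal G \<beta> K s \<and> s \<in> mla_hom K G)"


section \<open>Cocycles\<close>

text \<open>From here on the kernel is identified with its image \<open>N\<close> in \<open>G\<close>, so that all its elements
  are elements of \<open>G\<close>; as a multiplicative Lie algebra it is \<open>G\<lparr>carrier := N\<rparr>\<close>.\<close>

definition cocycle_f :: 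
  "('g, 'm) mla_scheme \<Rightarrow> ('k, 'n) mla_scheme \<Rightarrow> ('k \<Rightarrow> 'g) \<Rightarrow> 'k \<Rightarrow> 'k \<Rightarrow> 'g"
  where "cocycle_f G K t x y = t x \<otimes>\<^bsub>G\<^esub> t y \<otimes>\<^bsub>G\<^esub> inv\<^bsub>G\<^esub> t (x \<otimes>\<^bsub>K\<^esub> y)"

definition cocycle_h :: 
  "('g, 'm) mla_scheme \<Rightarrow> ('k, 'n) mla_scheme \<Rightarrow> ('k \<Rightarrow> 'g) \<Rightarrow> 'k \<Rightarrow> 'k \<Rightarrow> 'g"
  where "cocycle_h G K t x y = (t x \<star>\<^bsub>G\<^esub> t y) \<otimes>\<^bsub>G\<^esub> inv\<^bsub>G\<^esub> t (x \<star>\<^bsub>K\<^esub> y)"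

definition Gamma :: "('g, 'm) mla_scheme \<Rightarrow> ('k \<Rightarrow> 'g) \<Rightarrow> 'k \<Rightarrow> 'g \<Rightarrow> 'g"
  where "Gamma G t x a = t x \<star>\<^bsub>G\<^esub> a"

text \<open>Triviality of the class of \<open>(u, v, \<Gamma>)\<close> in the second cohomology, i.e. \<open>(u, v)\<close> is a
  2-coboundary.\<close>

definition trivial_class ::
  "('g, 'm) mla_scheme \<Rightarrow> ('k, 'n) mla_scheme \<Rightarrow> 'g set \<Rightarrow> ('k \<Rightarrow> 'g)
    \<Rightarrow> ('k \<Rightarrow> 'k \<Rightarrow> 'g) \<Rightarrow> ('k \<Rightarrow> 'k \<Rightarrow> 'g) \<Rightarrow> bool"
  where "trivial_class G K N t u v \<longleftrightarrow> (\<exists>l \<in> carrier K \<rightarrow> N. l \<one>\<^bsub>K\<^esub> = \<one>\<^bsub>G\<^esub>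
    \<and> (\<forall>x \<in> carrier K. \<forall>y \<in> carrier K.
        u x y = l x \<otimes>\<^bsub>G\<^esub> l y \<otimes>\<^bsub>G\<^esub> inv\<^bsub>G\<^esub> l (x \<otimes>\<^bsub>K\<^esub> y)
      \<and> v x y = Gamma G t x (l y) \<otimes>\<^bsub>G\<^esub> Gamma G t y (inv\<^bsub>G\<^esub> l x)
                  \<otimes>\<^bsub>G\<^esub> inv\<^bsub>G\<^esub> l (x \<star>\<^bsub>K\<^esub> y)))"

definition Z1 ::
  "('g, 'm) mla_scheme \<Rightarrow> ('k, 'n) mla_scheme \<Rightarrow> 'g set \<Rightarrow> ('k \<Rightarrow> 'g) \<Rightarrow> ('k \<Rightarrow> 'g) monoid"
  where "Z1 G K N t =
    \<lparr>carrier = {\<nu> \<in> carrier K \<rightarrow>\<^sub>E N. \<forall>x \<in> carrier K. \<forall>y \<in> carrier K.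
        \<nu> (x \<otimes>\<^bsub>K\<^esub> y) = \<nu> x \<otimes>\<^bsub>G\<^esub> \<nu> y
      \<and> \<nu> (x \<star>\<^bsub>K\<^esub> y) = Gamma G t x (\<nu> y) \<otimes>\<^bsub>G\<^esub> Gamma G t y (inv\<^bsub>G\<^esub> \<nu> x)},
     mult = \<lambda>\<nu> \<mu>. \<lambda>x \<in> carrier K. \<nu> x \<otimes>\<^bsub>G\<^esub> \<mu> x,
     one = \<lambda>x \<in> carrier K. \<one>\<^bsub>G\<^esub>\<rparr>"


section \<open>Groups of automorphisms of the extension\<close>

text \<open>\<open>Aut_sub\<close> is $\mathrm{Aut}_H(G)$, \<open>Aut_fix\<close> is $\mathrm{Aut}^H(G)$,
  \<open>Aut_fix_quot\<close> is $\mathrm{Aut}^{H,K}(G)$ and \<open>Aut_sub_quot\<close> is $\mathrm{Aut}_H^K(G)$.\<close>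

definition Aut_sub :: "('g, 'm) mla_scheme \<Rightarrow> 'g set \<Rightarrow> ('g \<Rightarrow> 'g) monoid"
  where "Aut_sub G N = mla_AutoGroup G \<lparr>carrier := {\<phi> \<in> mla_auto G. \<phi> ` N = N}\<rparr>"

definition Aut_fix :: "('g, 'm) mla_scheme \<Rightarrow> 'g set \<Rightarrow> ('g \<Rightarrow> 'g) monoid"
  where "Aut_fix G N = mla_AutoGroup G \<lparr>carrier := {\<phi> \<in> mla_auto G. \<forall>a \<in> N. \<phi> a = a}\<rparr>"

definition Aut_fix_quot :: "('g, 'm) mla_scheme \<Rightarrow> 'g set \<Rightarrow> ('g \<Rightarrow> 'g) monoid"
  where "Aut_fix_quot G N = mla_AutoGroup G \<lparr>carrier :=
    {\<phi> \<in> carrier (Aut_fix G N). \<forall>g \<in> carrier G. \<phi> g \<otimes>\<^bsub>G\<^esub> inv\<^bsub>G\<^esub> g \<in> N}\<rparr>"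

definition Aut_sub_quot :: "('g, 'm) mla_scheme \<Rightarrow> 'g set \<Rightarrow> ('g \<Rightarrow> 'g) monoid"
  where "Aut_sub_quot G N = mla_AutoGroup G \<lparr>carrier :=
    {\<phi> \<in> carrier (Aut_sub G N). \<forall>g \<in> carrier G. \<phi> g \<otimes>\<^bsub>G\<^esub> inv\<^bsub>G\<^esub> g \<in> N}\<rparr>"

definition Pi1 :: "'g set \<Rightarrow> ('g \<Rightarrow> 'g) \<Rightarrow> 'g \<Rightarrow> 'g"
  where "Pi1 N \<phi> = restrict \<phi> N"

definition Pi2 :: 
  "('k, 'n) mla_scheme \<Rightarrow> ('g \<Rightarrow> 'k) \<Rightarrow> ('k \<Rightarrow> 'g) \<Rightarrow> ('g \<Rightarrow> 'g) \<Rightarrow> 'k \<Rightarrow> 'k"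
  where "Pi2 K \<beta> t \<phi> = (\<lambda>x \<in> carrier K. \<beta> (\<phi> (t x)))"

definition Pi12 :: "('k, 'n) mla_scheme \<Rightarrow> 'g set \<Rightarrow> ('g \<Rightarrow> 'k) \<Rightarrow> ('k \<Rightarrow> 'g)
    \<Rightarrow> ('g \<Rightarrow> 'g) \<Rightarrow> ('g \<Rightarrow> 'g) \<times> ('k \<Rightarrow> 'k)"
  where "Pi12 K N \<beta> t \<phi> = (Pi1 N \<phi>, Pi2 K \<beta> t \<phi>)"

text \<open>The automorphism \<open>a t(x) \<mapsto> a \<nu>(x) t(x)\<close>: every \<open>g\<close> is uniquely \<open>a t(x)\<close> with
  \<open>x = \<beta> g\<close> and \<open>a = g t(x)\<inverse>\<close>.\<close>

definition Z1_to_Aut ::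
  "('g, 'm) mla_scheme \<Rightarrow> ('g \<Rightarrow> 'k) \<Rightarrow> ('k \<Rightarrow> 'g) \<Rightarrow> ('k \<Rightarrow> 'g) \<Rightarrow> 'g \<Rightarrow> 'g"
  where "Z1_to_Aut G \<beta> t \<nu> = (\<lambda>g \<in> carrier G.
    let x = \<beta> g; a = g \<otimes>\<^bsub>G\<^esub> inv\<^bsub>G\<^esub> t x in a \<otimes>\<^bsub>G\<^esub> \<nu> x \<otimes>\<^bsub>G\<^esub> t x)"

text \<open>The groups $C_1^{L^*}$, $C_2^{L^*}$ and $C^{L^*}$. \<open>C12\<close> is meaningful only in the
  central case, where \<open>\<Gamma>\<close> is trivial and hence compatibility with \<open>\<Gamma>\<close> is no condition.\<close>

definition C1 ::
  "('g, 'm) mla_scheme \<Rightarrow> ('k, 'n) mla_scheme \<Rightarrow> 'g set \<Rightarrow> ('k \<Rightarrow> 'g) \<Rightarrow> ('g \<Rightarrow> 'g) monoid"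
  where "C1 G K N t = mla_AutoGroup (G\<lparr>carrier := N\<rparr>) \<lparr>carrier :=
    {\<alpha> \<in> mla_auto (G\<lparr>carrier := N\<rparr>).
      (\<forall>x \<in> carrier K. \<forall>a \<in> N. \<alpha> (Gamma G t x a) = Gamma G t x (\<alpha> a))
      \<and> trivial_class G K N t
          (\<lambda>x y. cocycle_f G K t x y \<otimes>\<^bsub>G\<^esub> inv\<^bsub>G\<^esub> \<alpha> (cocycle_f G K t x y))
          (\<lambda>x y. cocycle_h G K t x y \<otimes>\<^bsub>G\<^esub> inv\<^bsub>G\<^esub> \<alpha> (cocycle_h G K t x y))}\<rparr>"

definition C2 ::
  "('g, 'm) mla_scheme \<Rightarrow> ('k, 'n) mla_scheme \<Rightarrow> 'g set \<Rightarrow> ('k \<Rightarrow> 'g) \<Rightarrow> ('k \<Rightarrow> 'k) monoid"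
  where "C2 G K N t = mla_AutoGroup K \<lparr>carrier :=
    {\<eta> \<in> mla_auto K.
      (\<forall>x \<in> carrier K. \<forall>a \<in> N. Gamma G t (\<eta> x) a = Gamma G t x a)
      \<and> trivial_class G K N t
          (\<lambda>x y. cocycle_f G K t (\<eta> x) (\<eta> y) \<otimes>\<^bsub>G\<^esub> inv\<^bsub>G\<^esub> cocycle_f G K t x y)
          (\<lambda>x y. cocycle_h G K t (\<eta> x) (\<eta> y) \<otimes>\<^bsub>G\<^esub> inv\<^bsub>G\<^esub> cocycle_h G K t x y)}\<rparr>"

definition C12 ::
  "('g, 'm) mla_scheme \<Rightarrow> ('k, 'n) mla_scheme \<Rightarrow> 'g set \<Rightarrow> ('k \<Rightarrow> 'g)
    \<Rightarrow> (('g \<Rightarrow> 'g) \<times> ('k \<Rightarrow> 'k)) monoid"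
  where "C12 G K N t = (mla_AutoGroup (G\<lparr>carrier := N\<rparr>) \<times>\<times> mla_AutoGroup K) \<lparr>carrier :=
    {(\<alpha>, \<eta>). \<alpha> \<in> mla_auto (G\<lparr>carrier := N\<rparr>) \<and> \<eta> \<in> mla_auto K
      \<and> trivial_class G K N t
          (\<lambda>x y. cocycle_f G K t (\<eta> x) (\<eta> y) \<otimes>\<^bsub>G\<^esub> inv\<^bsub>G\<^esub> \<alpha> (cocycle_f G K t x y))
          (\<lambda>x y. cocycle_h G K t (\<eta> x) (\<eta> y) \<otimes>\<^bsub>G\<^esub> inv\<^bsub>G\<^esub> \<alpha> (cocycle_h G K t x y))}\<rparr>"

end

theory Submission
  imports Defs
begin

text \<open>A splitting \<open>s\<close> makes \<open>G\<close> a semidirect product: every element is uniquely \<open>a s(x)\<close> with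
  \<open>a \<in> N\<close>, \<open>x \<in> K\<close>, and both operations of \<open>G\<close> are determined by those of \<open>N\<close> and \<open>K\<close>
  together with the action \<open>\<Gamma>\<^sub>x(a) = s(x) \<star> a\<close> (\<open>star_expand\<close>). Call automorphisms \<open>\<alpha>\<close> of \<open>N\<close>
  and \<open>\<eta>\<close> of \<open>K\<close> compatible if \<open>\<alpha>\<close> commutes with every \<open>\<Gamma>\<^sub>x\<close> and \<open>\<Gamma>\<close> is unchanged by \<open>\<eta>\<close>.
  For such a pair the map \<open>a s(x) \<mapsto> \<alpha>(a) s(\<eta>(x))\<close> is an automorphism of \<open>G\<close> which induces
  \<open>\<alpha>\<close> on \<open>N\<close> and \<open>\<eta>\<close> on \<open>K\<close> (\<open>lift_mla_auto\<close>, \<open>Pi1_lift\<close>, \<open>Pi2_lift\<close>), and it depends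
  multiplicatively on the pair (\<open>lift_compose\<close>). This lift is the homomorphism that splits all
  three sequences: it is applied to the pairs \<open>(\<alpha>, id)\<close>, \<open>(id, \<eta>)\<close> and \<open>(\<alpha>, \<eta>)\<close>.

  It remains to see that the right-hand groups of the sequences consist exactly of compatible
  pairs, that is, that triviality of the cohomology classes is automatic. Any transversal has the
  form \<open>t(x) = c(x) s(x)\<close> with \<open>c\<close> taking values in \<open>N\<close>, so its cocycles are the coboundary of
  \<open>c\<close>; transforming them by a compatible pair gives the coboundary of
  \<open>x \<mapsto> c(\<eta>(x)) \<alpha>(c(x))\<inverse>\<close> (\<open>trivial_class_compatible\<close>). Conversely the restriction to \<open>N\<close> and
  the map induced on \<open>K\<close> by an automorphism of \<open>G\<close> satisfy
  \<open>\<alpha>(\<Gamma>\<^sub>x(a)) = \<Gamma>\<^bsub>\<eta>(x)\<^esub>(\<alpha>(a))\<close> (\<open>Pi1_star\<close>), which yields compatibility as soon as \<open>\<alpha>\<close> or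
  \<open>\<eta>\<close> is the identity. For a central extension \<open>\<Gamma>\<close> is trivial and every pair is compatible.

  On the group of automorphisms of \<open>G\<close> preserving \<open>N\<close>, both \<open>\<Pi>\<^sub>1\<close> and \<open>\<Pi>\<^sub>2\<close> are
  homomorphisms, and the smaller groups of automorphisms of \<open>G\<close> are the kernel of \<open>\<Pi>\<^sub>1\<close>, the
  kernel of \<open>\<Pi>\<^sub>2\<close> and their intersection. An automorphism \<open>\<phi>\<close>
  in both kernels of a central extension corresponds to the 1-cocycle
  \<open>x \<mapsto> \<phi>(s(x)) s(x)\<inverse>\<close> (\<open>Aut_fix_quot_in_Z1_image\<close>).\<close>

section \<open>The star operation\<close>

context mult_lie_algebra
begin

lemma conj_by_closed [simp]:
  "\<lbrakk>x \<in> carrier G; z \<in> carrier G\<rbrakk> \<Longrightarrow> conj_by G z x \<in> carrier G"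
  by (simp add: conj_by_def)

lemma conj_by_one [simp]: "z \<in> carrier G \<Longrightarrow> conj_by G z \<one> = \<one>"
  by (simp add: conj_by_def)

lemma star_one_right: "x \<in> carrier G \<Longrightarrow> x \<star> \<one> = \<one>"
  using star_mult_right[of x \<one> \<one>] star_closed[of x \<one>]
  by (simp add: conj_by_def)

lemma star_one_left: "x \<in> carrier G \<Longrightarrow> \<one> \<star> x = \<one>"
  using star_mult_left[of \<one> \<one> x] star_closed[of \<one> x]
  by (simp add: conj_by_def)

text \<open>Expanding \<open>(x y) \<star> (x y) = 1\<close> on both sides leaves the conjugate of \<open>(y \<star> x)(x \<star> y)\<close> by
  \<open>x\<close>.\<close>

lemma star_swap:
  assumes x: "x \<in> carrier G" and y: "y \<in> carrier G"
  shows "y \<star> x = inv (x \<star> y)"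
proof -
  have yx: "y \<star> x \<in> carrier G" and xy: "x \<star> y \<in> carrier G"
    by (simp_all add: x y star_closed)
  have "(x \<otimes> y) \<star> (x \<otimes> y) = ((x \<otimes> y) \<star> x) \<otimes> conj_by G x ((x \<otimes> y) \<star> y)"
    by (rule star_mult_right) (simp_all add: x y)
  also have "\<dots> = conj_by G x (y \<star> x) \<otimes> conj_by G x (x \<star> y)"
    using x y xy yx by (simp add: star_mult_left star_self)
  also have "\<dots> = conj_by G x ((y \<star> x) \<otimes> (x \<star> y))"
    using x y xy yx by (simp add: conj_by_def m_assoc inv_solve_left')
  finally have "conj_by G x ((y \<star> x) \<otimes> (x \<star> y)) = \<one>"
    using x y by (simp add: star_self)
  then have "x \<otimes> ((y \<star> x) \<otimes> (x \<star> y)) = x"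
    using x xy yx inv_solve_right'[of \<one> "x \<otimes> ((y \<star> x) \<otimes> (x \<star> y))" x]
    by (simp add: conj_by_def)
  then have "(y \<star> x) \<otimes> (x \<star> y) = \<one>"
    using x xy yx by (simp add: r_cancel_one')
  then show ?thesis
    using xy yx by (metis inv_equality)
qed

end


section \<open>Automorphism groups\<close>

lemma mla_autoD:
  assumes "\<phi> \<in> mla_auto X"
  shows "\<phi> \<in> extensional (carrier X)" "bij_betw \<phi> (carrier X) (carrier X)"
    "\<And>x. x \<in> carrier X \<Longrightarrow> \<phi> x \<in> carrier X"
    "\<And>x y. \<lbrakk>x \<in> carrier X; y \<in> carrier X\<rbrakk> \<Longrightarrow> \<phi> (x \<otimes>\<^bsub>X\<^esub> y) = \<phi> x \<otimes>\<^bsub>X\<^esub> \<phi> y"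
    "\<And>x y. \<lbrakk>x \<in> carrier X; y \<in> carrier X\<rbrakk> \<Longrightarrow> \<phi> (x \<star>\<^bsub>X\<^esub> y) = \<phi> x \<star>\<^bsub>X\<^esub> \<phi> y"
    "\<phi> \<in> Bij (carrier X)"
  using assms by (auto simp: mla_auto_def mla_hom_def Bij_def hom_def)

lemma mla_autoI:
  assumes "\<phi> \<in> extensional (carrier X)" "bij_betw \<phi> (carrier X) (carrier X)"
    "\<And>x y. \<lbrakk>x \<in> carrier X; y \<in> carrier X\<rbrakk> \<Longrightarrow> \<phi> (x \<otimes>\<^bsub>X\<^esub> y) = \<phi> x \<otimes>\<^bsub>X\<^esub> \<phi> y"
    "\<And>x y. \<lbrakk>x \<in> carrier X; y \<in> carrier X\<rbrakk> \<Longrightarrow> \<phi> (x \<star>\<^bsub>X\<^esub> y) = \<phi> x \<star>\<^bsub>X\<^esub> \<phi> y"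
  shows "\<phi> \<in> mla_auto X"
  using assms by (auto simp: mla_auto_def mla_hom_def Bij_def hom_def bij_betw_def)

text \<open>Stated for any carrier closed under both operations, so that the facts apply to the kernel as a
  substructure of \<open>G\<close> as well as to \<open>G\<close> and \<open>K\<close> themselves.\<close>

lemma id_mla_auto:
  assumes "\<And>x y. \<lbrakk>x \<in> carrier X; y \<in> carrier X\<rbrakk> \<Longrightarrow> x \<otimes>\<^bsub>X\<^esub> y \<in> carrier X"
    and "\<And>x y. \<lbrakk>x \<in> carrier X; y \<in> carrier X\<rbrakk> \<Longrightarrow> x \<star>\<^bsub>X\<^esub> y \<in> carrier X"
  shows "(\<lambda>x\<in>carrier X. x) \<in> mla_auto X"
  by (rule mla_autoI) (use assms in \<open>auto simp: bij_betw_def inj_on_def\<close>)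

lemma compose_mla_auto:
  assumes "\<phi> \<in> mla_auto X" "\<psi> \<in> mla_auto X"
    and "\<And>x y. \<lbrakk>x \<in> carrier X; y \<in> carrier X\<rbrakk> \<Longrightarrow> x \<otimes>\<^bsub>X\<^esub> y \<in> carrier X"
    and "\<And>x y. \<lbrakk>x \<in> carrier X; y \<in> carrier X\<rbrakk> \<Longrightarrow> x \<star>\<^bsub>X\<^esub> y \<in> carrier X"
  shows "compose (carrier X) \<phi> \<psi> \<in> mla_auto X"
  by (rule mla_autoI)
    (use assms in \<open>auto simp: mla_autoD compose_eq intro: bij_betw_compose mla_autoD(2)\<close>)

lemma inv_mla_auto:
  assumes \<phi>: "\<phi> \<in> mla_auto X"
    and cl: "\<And>x y. \<lbrakk>x \<in> carrier X; y \<in> carrier X\<rbrakk> \<Longrightarrow> x \<otimes>\<^bsub>X\<^esub> y \<in> carrier X"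
      "\<And>x y. \<lbrakk>x \<in> carrier X; y \<in> carrier X\<rbrakk> \<Longrightarrow> x \<star>\<^bsub>X\<^esub> y \<in> carrier X"
  shows "(\<lambda>x\<in>carrier X. inv_into (carrier X) \<phi> x) \<in> mla_auto X"
proof (rule mla_autoI)
  note B = mla_autoD(6)[OF \<phi>]
  show "bij_betw (\<lambda>x\<in>carrier X. inv_into (carrier X) \<phi> x) (carrier X) (carrier X)"
    using mla_autoD(2)[OF \<phi>] by (simp add: bij_betw_inv_into)
  fix x y assume xy: "x \<in> carrier X" "y \<in> carrier X"
  show "(\<lambda>x\<in>carrier X. inv_into (carrier X) \<phi> x) (x \<otimes>\<^bsub>X\<^esub> y) =
      (\<lambda>x\<in>carrier X. inv_into (carrier X) \<phi> x) x \<otimes>\<^bsub>X\<^esub> (\<lambda>x\<in>carrier X. inv_into (carrier X) \<phi> x) y"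
    using xy cl Bij_inv_into_lemma[of "carrier X" \<phi> "mult X" x y] mla_autoD[OF \<phi>] by auto
  show "(\<lambda>x\<in>carrier X. inv_into (carrier X) \<phi> x) (x \<star>\<^bsub>X\<^esub> y) =
      (\<lambda>x\<in>carrier X. inv_into (carrier X) \<phi> x) x \<star>\<^bsub>X\<^esub> (\<lambda>x\<in>carrier X. inv_into (carrier X) \<phi> x) y"
    using xy cl Bij_inv_into_lemma[of "carrier X" \<phi> "star X" x y] mla_autoD[OF \<phi>] by auto
qed simp

lemma mla_AutoGroup_simps [simp]:
  "carrier (mla_AutoGroup X) = mla_auto X"
  "\<one>\<^bsub>mla_AutoGroup X\<^esub> = (\<lambda>x\<in>carrier X. x)"
  "\<lbrakk>\<phi> \<in> mla_auto X; \<psi> \<in> mla_auto X\<rbrakk> \<Longrightarrow> \<phi> \<otimes>\<^bsub>mla_AutoGroup X\<^esub> \<psi> = compose (carrier X) \<phi> \<psi>"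
  by (auto simp: mla_AutoGroup_def BijGroup_def mla_auto_def)

lemma group_mla_AutoGroup:
  assumes "\<And>x y. \<lbrakk>x \<in> carrier X; y \<in> carrier X\<rbrakk> \<Longrightarrow> x \<otimes>\<^bsub>X\<^esub> y \<in> carrier X"
    and "\<And>x y. \<lbrakk>x \<in> carrier X; y \<in> carrier X\<rbrakk> \<Longrightarrow> x \<star>\<^bsub>X\<^esub> y \<in> carrier X"
  shows "group (mla_AutoGroup X)"
proof (rule groupI)
  fix \<phi> assume \<phi>: "\<phi> \<in> carrier (mla_AutoGroup X)"
  then show "\<exists>\<psi>\<in>carrier (mla_AutoGroup X). \<psi> \<otimes>\<^bsub>mla_AutoGroup X\<^esub> \<phi> = \<one>\<^bsub>mla_AutoGroup X\<^esub>"
    using inv_mla_auto[OF _ assms] Bij_compose_restrict_eq[OF mla_autoD(6)]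
    by (intro bexI[of _ "\<lambda>x\<in>carrier X. inv_into (carrier X) \<phi> x"]) auto
qed (use assms in \<open>auto simp: compose_mla_auto id_mla_auto compose_assoc[symmetric] mla_autoD
       Pi_iff\<close>)

lemma inv_mla_AutoGroup:
  assumes "\<phi> \<in> mla_auto X"
    and "\<And>x y. \<lbrakk>x \<in> carrier X; y \<in> carrier X\<rbrakk> \<Longrightarrow> x \<otimes>\<^bsub>X\<^esub> y \<in> carrier X"
    and "\<And>x y. \<lbrakk>x \<in> carrier X; y \<in> carrier X\<rbrakk> \<Longrightarrow> x \<star>\<^bsub>X\<^esub> y \<in> carrier X"
  shows "inv\<^bsub>mla_AutoGroup X\<^esub> \<phi> = (\<lambda>x\<in>carrier X. inv_into (carrier X) \<phi> x)"
  using assms(1) inv_mla_auto[OF assms] Bij_compose_restrict_eq[OF mla_autoD(6)[OF assms(1)]]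
  by (intro group.inv_equality[OF group_mla_AutoGroup[OF assms(2,3)]]) simp_all


section \<open>Short exact sequences from restrictions of a homomorphism\<close>

text \<open>The section makes \<open>p\<close> surjective, which is the only part of exactness not among the premises.\<close>

lemma split_short_exactI:
  assumes "group A" "group B" "group C"
    and "j \<in> mon A B" "p \<in> hom B C" "j ` carrier A = kernel B C p"
    and "\<delta> \<in> hom C B" and "\<And>c. c \<in> carrier C \<Longrightarrow> p (\<delta> c) = c"
  shows "short_exact A B C j p \<and> group_split B C p"
proof -
  have "c \<in> p ` carrier B" if "c \<in> carrier C" for c
    using that assms(7,8) by (force simp: hom_def Pi_iff image_iff)
  then have "p \<in> epi B C"
    using assms(5) by (auto simp: epi_def hom_def)
  then show ?thesis
    using assms by (auto simp: short_exact_def group_split_def)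
qed

text \<open>The shape shared by the two sequences for center extensions: \<open>p\<close> is restricted to a subgroup
  of its domain. The section identifies \<open>C'\<close> with the image, hence \<open>C'\<close> is a subgroup.\<close>

lemma split_short_exact_restrict:
  assumes B: "group B" and C: "group C" and p: "p \<in> hom B C"
    and B': "subgroup B' B" and A: "A = {b \<in> B'. p b = \<one>\<^bsub>C\<^esub>}"
    and C': "p ` B' \<subseteq> C'" "C' \<subseteq> carrier C"
    and \<delta>: "\<delta> \<in> C' \<rightarrow> B'" "\<And>c. c \<in> C' \<Longrightarrow> p (\<delta> c) = c"
      "\<And>c d. \<lbrakk>c \<in> C'; d \<in> C'\<rbrakk> \<Longrightarrow> \<delta> (c \<otimes>\<^bsub>C\<^esub> d) = \<delta> c \<otimes>\<^bsub>B\<^esub> \<delta> d"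
  shows "short_exact (B\<lparr>carrier := A\<rparr>) (B\<lparr>carrier := B'\<rparr>) (C\<lparr>carrier := C'\<rparr>) (\<lambda>b. b) p
    \<and> group_split (B\<lparr>carrier := B'\<rparr>) (C\<lparr>carrier := C'\<rparr>) p"
proof -
  let ?B = "B\<lparr>carrier := B'\<rparr>"
  have gB: "group ?B"
    by (rule subgroup.subgroup_is_group[OF B' B])
  have B'B: "B' \<subseteq> carrier B"
    by (rule subgroup.subset[OF B'])
  have pB: "p \<in> hom ?B C"
    using p B'B by (auto simp: hom_def)
  interpret p: group_hom ?B C p
    by (intro group_hom.intro group_hom_axioms.intro gB C pB)
  have "C' = p ` B'"
    using C' \<delta>(1,2) by (force simp: image_iff)
  then have "subgroup C' C"
    using p.img_is_subgroup by simp
  then have gC: "group (C\<lparr>carrier := C'\<rparr>)"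
    by (rule subgroup.subgroup_is_group[OF _ C])
  have "kernel ?B C p = A"
    by (auto simp: kernel_def A)
  then have "subgroup A ?B"
    using p.subgroup_kernel by simp
  then have gA: "group (B\<lparr>carrier := A\<rparr>)"
    using subgroup.subgroup_is_group[OF _ gB] by fastforce
  have incl: "(\<lambda>b. b) \<in> mon (B\<lparr>carrier := A\<rparr>) ?B"
    using A by (auto simp: mon_def hom_def)
  have pC': "p \<in> hom ?B (C\<lparr>carrier := C'\<rparr>)"
    using C'(1) p.hom_mult by (auto simp: hom_def)
  have \<delta>C': "\<delta> \<in> hom (C\<lparr>carrier := C'\<rparr>) ?B"
    using \<delta> by (auto simp: hom_def)
  show ?thesis
    by (rule split_short_exactI[OF gA gB gC incl pC' _ \<delta>C']) (auto simp: kernel_def A \<delta>(2))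
qed


section \<open>Split center extensions\<close>

text \<open>The kernel is represented by its image in \<open>G\<close> only. The homomorphic section \<open>s\<close> and the
  transversal \<open>t\<close> are kept apart, since cocycles refer to an arbitrary transversal.\<close>

locale split_center_extension =
  G: mult_lie_algebra G + K: mult_lie_algebra K
  for G :: "('g, 'm) mla_scheme" (structure) and K :: "('k, 'n) mla_scheme" +
  fixes \<beta> :: "'g \<Rightarrow> 'k" and N :: "'g set" and s t :: "'k \<Rightarrow> 'g"
  assumes proj_hom: "\<beta> \<in> mla_hom G K"
    and N_eq: "N = kernel G K \<beta>"
    and N_center: "N \<subseteq> group_center G"
    and star_N: "\<lbrakk>a \<in> N; b \<in> N\<rbrakk> \<Longrightarrow> a \<star> b = \<one>"
    and section_hom: "s \<in> mla_hom K G"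
    and proj_section [simp]: "x \<in> carrier K \<Longrightarrow> \<beta> (s x) = x"
    and transversal: "transversal G \<beta> K t"
begin

lemma proj_simps [simp]:
  "g \<in> carrier G \<Longrightarrow> \<beta> g \<in> carrier K"
  "\<lbrakk>g \<in> carrier G; h \<in> carrier G\<rbrakk> \<Longrightarrow> \<beta> (g \<otimes> h) = \<beta> g \<otimes>\<^bsub>K\<^esub> \<beta> h"
  "\<lbrakk>g \<in> carrier G; h \<in> carrier G\<rbrakk> \<Longrightarrow> \<beta> (g \<star> h) = \<beta> g \<star>\<^bsub>K\<^esub> \<beta> h"
  using proj_hom by (auto simp: mla_hom_def hom_def)

lemma section_simps [simp]:
  "x \<in> carrier K \<Longrightarrow> s x \<in> carrier G"
  "\<lbrakk>x \<in> carrier K; y \<in> carrier K\<rbrakk> \<Longrightarrow> s (x \<otimes>\<^bsub>K\<^esub> y) = s x \<otimes> s y"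
  "\<lbrakk>x \<in> carrier K; y \<in> carrier K\<rbrakk> \<Longrightarrow> s (x \<star>\<^bsub>K\<^esub> y) = s x \<star> s y"
  using section_hom by (auto simp: mla_hom_def hom_def)

lemma transversal_simps [simp]:
  "x \<in> carrier K \<Longrightarrow> t x \<in> carrier G"
  "x \<in> carrier K \<Longrightarrow> \<beta> (t x) = x"
  "t \<one>\<^bsub>K\<^esub> = \<one>"
  using transversal by (auto simp: transversal_def)

lemmas [simp] = G.star_closed K.star_closed

interpretation proj: group_hom G K \<beta>
  using proj_hom by unfold_locales (simp add: mla_hom_def)

interpretation sec: group_hom K G s
  using section_hom by unfold_locales (simp add: mla_hom_def)

lemma proj_inv [simp]: "g \<in> carrier G \<Longrightarrow> \<beta> (inv g) = inv\<^bsub>K\<^esub> \<beta> g"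
  by (rule proj.hom_inv)

lemma proj_one [simp]: "\<beta> \<one> = \<one>\<^bsub>K\<^esub>"
  by (rule proj.hom_one)

lemma section_one [simp]: "s \<one>\<^bsub>K\<^esub> = \<one>"
  by (rule sec.hom_one)

lemma N_iff: "g \<in> N \<longleftrightarrow> g \<in> carrier G \<and> \<beta> g = \<one>\<^bsub>K\<^esub>"
  by (auto simp: N_eq kernel_def)

text \<open>Used as an introduction rule: as a rewrite rule the characterization of \<open>N\<close> would loop
  with the rules deriving membership in the carrier from membership in \<open>N\<close>.\<close>

lemma N_I: "\<lbrakk>g \<in> carrier G; \<beta> g = \<one>\<^bsub>K\<^esub>\<rbrakk> \<Longrightarrow> g \<in> N"
  by (simp add: N_iff)

lemma N_simps [simp]:
  "a \<in> N \<Longrightarrow> a \<in> carrier G"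
  "a \<in> N \<Longrightarrow> \<beta> a = \<one>\<^bsub>K\<^esub>"
  "a \<in> N \<Longrightarrow> inv a \<in> N"
  "\<lbrakk>a \<in> N; b \<in> N\<rbrakk> \<Longrightarrow> a \<otimes> b \<in> N"
  "\<one> \<in> N"
  by (auto simp: N_iff)

lemma star_in_N [simp]:
  assumes "g \<in> carrier G" "a \<in> N"
  shows "g \<star> a \<in> N" "a \<star> g \<in> N"
  using assms by (auto intro!: N_I simp: K.star_one_right K.star_one_left)

lemma N_commute: "\<lbrakk>a \<in> N; g \<in> carrier G\<rbrakk> \<Longrightarrow> a \<otimes> g = g \<otimes> a"
  using N_center by (auto simp: group_center_def)

lemma N_left_commute:
  "\<lbrakk>a \<in> N; g \<in> carrier G; h \<in> carrier G\<rbrakk> \<Longrightarrow> g \<otimes> (a \<otimes> h) = a \<otimes> (g \<otimes> h)"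
  by (metis N_commute N_simps(1) G.m_assoc)

lemma conj_by_N [simp]: "\<lbrakk>a \<in> N; g \<in> carrier G\<rbrakk> \<Longrightarrow> conj_by G a g = g"
  by (simp add: conj_by_def N_commute[of a g] G.m_assoc)

lemma conj_by_on_N [simp]: "\<lbrakk>a \<in> N; g \<in> carrier G\<rbrakk> \<Longrightarrow> conj_by G g a = a"
  by (simp add: conj_by_def N_commute[of a g, symmetric] G.m_assoc)

lemma mult_N_star: "\<lbrakk>g \<in> carrier G; a \<in> N; b \<in> N\<rbrakk> \<Longrightarrow> (a \<otimes> g) \<star> b = g \<star> b"
  by (simp add: G.star_mult_left star_N)

text \<open>The action on \<open>N\<close> factors through \<open>K\<close> because two preimages of the same element differ by
  an element of \<open>N\<close>, which is central and acts trivially on \<open>N\<close>. In particular \<open>\<Gamma>\<close> is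
  independent of the transversal.\<close>

lemma star_N_cong:
  assumes "g \<in> carrier G" "h \<in> carrier G" "\<beta> g = \<beta> h" "a \<in> N"
  shows "g \<star> a = h \<star> a"
proof -
  have "g \<otimes> inv h \<in> N"
    using assms by (intro N_I) simp_all
  then have "((g \<otimes> inv h) \<otimes> h) \<star> a = h \<star> a"
    using assms by (intro mult_N_star) auto
  then show ?thesis
    using assms by (simp add: G.m_assoc)
qed

lemma star_mult_N: "\<lbrakk>g \<in> carrier G; a \<in> N; b \<in> N\<rbrakk> \<Longrightarrow> g \<star> (a \<otimes> b) = (g \<star> a) \<otimes> (g \<star> b)"
  by (simp add: G.star_mult_right)

lemma star_inv_N: "\<lbrakk>g \<in> carrier G; a \<in> N\<rbrakk> \<Longrightarrow> g \<star> inv a = inv (g \<star> a)"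
  using star_mult_N[of g "inv a" a]
  by (intro G.inv_equality[symmetric]) (simp_all add: G.star_one_right)

text \<open>The rule for computing star in coordinates. Expanding both arguments creates only conjugates
  by or of elements of \<open>N\<close>, which are trivial, and a term \<open>a \<star> b\<close> with both factors in \<open>N\<close>.\<close>

lemma star_expand:
  assumes "a \<in> N" "b \<in> N" "g \<in> carrier G" "h \<in> carrier G"
  shows "(a \<otimes> g) \<star> (b \<otimes> h) = ((g \<star> b) \<otimes> inv (h \<star> a)) \<otimes> (g \<star> h)"
proof -
  have "(a \<otimes> g) \<star> (b \<otimes> h) = ((a \<otimes> g) \<star> b) \<otimes> ((a \<otimes> g) \<star> h)"
    using assms by (simp add: G.star_mult_right)
  also have "\<dots> = (g \<star> b) \<otimes> ((g \<star> h) \<otimes> (a \<star> h))"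
    using assms by (simp add: mult_N_star G.star_mult_left)
  also have "\<dots> = ((g \<star> b) \<otimes> inv (h \<star> a)) \<otimes> (g \<star> h)"
    using assms by (simp add: G.star_swap[of h a] N_commute[of "inv (h \<star> a)"] G.m_assoc)
  finally show ?thesis .
qed

lemma decompose:
  assumes "g \<in> carrier G"
  obtains a x where "a \<in> N" "x \<in> carrier K" "g = a \<otimes> s x"
proof
  show "g \<otimes> inv s (\<beta> g) \<in> N"
    using assms by (intro N_I) simp_all
  show "g = (g \<otimes> inv s (\<beta> g)) \<otimes> s (\<beta> g)"
    using assms by (simp add: G.m_assoc)
qed (simp add: assms)

abbreviation "NG \<equiv> G\<lparr>carrier := N\<rparr>"

lemma group_Aut_N: "group (mla_AutoGroup NG)"
  by (rule group_mla_AutoGroup) auto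

lemma group_Aut_K: "group (mla_AutoGroup K)"
  by (rule group_mla_AutoGroup) auto

lemma mla_auto_N_simps:
  assumes "\<alpha> \<in> mla_auto NG"
  shows "a \<in> N \<Longrightarrow> \<alpha> a \<in> N"
    "\<lbrakk>a \<in> N; b \<in> N\<rbrakk> \<Longrightarrow> \<alpha> (a \<otimes> b) = \<alpha> a \<otimes> \<alpha> b"
    "\<alpha> \<one> = \<one>"
    "a \<in> N \<Longrightarrow> \<alpha> (inv a) = inv \<alpha> a"
proof -
  show cl: "\<alpha> a \<in> N" if "a \<in> N" for a
    using mla_autoD(3)[OF assms] that by simp
  show m: "\<alpha> (a \<otimes> b) = \<alpha> a \<otimes> \<alpha> b" if "a \<in> N" "b \<in> N" for a b
    using mla_autoD(4)[OF assms] that by simp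
  show one: "\<alpha> \<one> = \<one>"
    using m[of \<one> \<one>] cl[of \<one>] by simp
  show "\<alpha> (inv a) = inv \<alpha> a" if "a \<in> N"
    using m[of "inv a" a] one cl that by (intro G.inv_equality[symmetric]) simp_all
qed

lemma mla_auto_K_one:
  assumes "\<eta> \<in> mla_auto K"
  shows "\<eta> \<one>\<^bsub>K\<^esub> = \<one>\<^bsub>K\<^esub>"
  using mla_autoD(4)[OF assms, of "\<one>\<^bsub>K\<^esub>" "\<one>\<^bsub>K\<^esub>"] mla_autoD(3)[OF assms, of "\<one>\<^bsub>K\<^esub>"] by simp


section \<open>Compatible pairs and their lifts\<close>

text \<open>Both invariance conditions together are stronger than the single condition
  \<open>\<alpha>(\<Gamma>\<^sub>x(a)) = \<Gamma>\<^bsub>\<eta>(x)\<^esub>(\<alpha>(a))\<close> that a lift requires; they are what makes the transformed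
  cocycles coboundaries with respect to the original \<open>\<Gamma>\<close>.\<close>

definition compatible :: "('g \<Rightarrow> 'g) \<Rightarrow> ('k \<Rightarrow> 'k) \<Rightarrow> bool"
  where "compatible \<alpha> \<eta> \<longleftrightarrow> \<alpha> \<in> mla_auto NG \<and> \<eta> \<in> mla_auto K
    \<and> (\<forall>x\<in>carrier K. \<forall>a\<in>N. \<alpha> (Gamma G t x a) = Gamma G t x (\<alpha> a)
        \<and> Gamma G t (\<eta> x) a = Gamma G t x a)"

text \<open>In coordinates this is \<open>a s(x) \<mapsto> \<alpha>(a) s(\<eta>(x))\<close>, see \<open>lift_eq\<close>.\<close>

definition lift :: "('g \<Rightarrow> 'g) \<Rightarrow> ('k \<Rightarrow> 'k) \<Rightarrow> 'g \<Rightarrow> 'g"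
  where "lift \<alpha> \<eta> = (\<lambda>g\<in>carrier G. \<alpha> (g \<otimes> inv s (\<beta> g)) \<otimes> s (\<eta> (\<beta> g)))"

lemma Gamma_eq: "\<lbrakk>x \<in> carrier K; a \<in> N\<rbrakk> \<Longrightarrow> Gamma G t x a = s x \<star> a"
  unfolding Gamma_def by (rule star_N_cong) simp_all

lemma compatibleD:
  assumes "compatible \<alpha> \<eta>"
  shows "\<alpha> \<in> mla_auto NG" "\<eta> \<in> mla_auto K"
    "\<lbrakk>x \<in> carrier K; a \<in> N\<rbrakk> \<Longrightarrow> \<alpha> (s x \<star> a) = s x \<star> \<alpha> a"
    "\<lbrakk>x \<in> carrier K; a \<in> N\<rbrakk> \<Longrightarrow> s (\<eta> x) \<star> a = s x \<star> a"
proof -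
  show \<alpha>: "\<alpha> \<in> mla_auto NG" and \<eta>: "\<eta> \<in> mla_auto K"
    using assms by (auto simp: compatible_def)
  show "\<alpha> (s x \<star> a) = s x \<star> \<alpha> a" "s (\<eta> x) \<star> a = s x \<star> a" if "x \<in> carrier K" "a \<in> N"
    using assms that mla_auto_N_simps(1)[OF \<alpha>] mla_autoD(3)[OF \<eta>]
    by (auto simp: compatible_def Gamma_eq)
qed

lemma lift_eq:
  assumes "compatible \<alpha> \<eta>" "a \<in> N" "x \<in> carrier K"
  shows "lift \<alpha> \<eta> (a \<otimes> s x) = \<alpha> a \<otimes> s (\<eta> x)"
  using assms by (simp add: lift_def G.m_assoc)

lemma lift_on_N:
  assumes "compatible \<alpha> \<eta>" "a \<in> N"
  shows "lift \<alpha> \<eta> a = \<alpha> a"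
  using lift_eq[OF assms, of "\<one>\<^bsub>K\<^esub>"] assms mla_auto_N_simps(1)[OF compatibleD(1)[OF assms(1)]]
  by (simp add: mla_auto_K_one compatibleD(2))

lemma proj_lift:
  assumes "compatible \<alpha> \<eta>" "g \<in> carrier G"
  shows "\<beta> (lift \<alpha> \<eta> g) = \<eta> (\<beta> g)"
proof -
  have "g \<otimes> inv s (\<beta> g) \<in> N"
    using assms by (intro N_I) simp_all
  then show ?thesis
    using assms mla_auto_N_simps(1)[OF compatibleD(1)[OF assms(1)]]
      mla_autoD(3)[OF compatibleD(2)[OF assms(1)]]
    by (simp add: lift_def)
qed

text \<open>In coordinates star has the \<open>N\<close>-component \<open>\<Gamma>\<^sub>x(b) \<Gamma>\<^sub>y(a)\<inverse>\<close> and the \<open>K\<close>-component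
  \<open>x \<star> y\<close>; compatibility says that \<open>\<alpha>\<close> carries the former to the expression for the images.
  Bijectivity holds in each coordinate.\<close>

lemma lift_mla_auto:
  assumes c: "compatible \<alpha> \<eta>"
  shows "lift \<alpha> \<eta> \<in> mla_auto G"
proof (rule mla_autoI)
  note \<alpha> = mla_auto_N_simps[OF compatibleD(1)[OF c]]
  note \<eta> = mla_autoD(3-5)[OF compatibleD(2)[OF c]]
  note [simp] = \<alpha> \<eta>
  show "lift \<alpha> \<eta> \<in> extensional (carrier G)"
    by (simp add: lift_def)
  show "lift \<alpha> \<eta> (g \<otimes> h) = lift \<alpha> \<eta> g \<otimes> lift \<alpha> \<eta> h"
    if gh: "g \<in> carrier G" "h \<in> carrier G" for g h
  proof -
    obtain a x where g: "a \<in> N" "x \<in> carrier K" "g = a \<otimes> s x"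
      using decompose[OF gh(1)] .
    obtain b y where h: "b \<in> N" "y \<in> carrier K" "h = b \<otimes> s y"
      using decompose[OF gh(2)] .
    have "g \<otimes> h = (a \<otimes> b) \<otimes> s (x \<otimes>\<^bsub>K\<^esub> y)"
      using g h by (simp add: G.m_assoc N_left_commute)
    then have "lift \<alpha> \<eta> (g \<otimes> h) = (\<alpha> a \<otimes> \<alpha> b) \<otimes> (s (\<eta> x) \<otimes> s (\<eta> y))"
      using g h by (simp only: lift_eq[OF c] N_simps K.m_closed) simp
    also have "\<dots> = (\<alpha> a \<otimes> s (\<eta> x)) \<otimes> (\<alpha> b \<otimes> s (\<eta> y))"
      using g h by (simp add: G.m_assoc N_left_commute)
    finally show ?thesis
      using g h by (simp add: lift_eq[OF c])
  qed
  show "lift \<alpha> \<eta> (g \<star> h) = lift \<alpha> \<eta> g \<star> lift \<alpha> \<eta> h"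
    if gh: "g \<in> carrier G" "h \<in> carrier G" for g h
  proof -
    obtain a x where g: "a \<in> N" "x \<in> carrier K" "g = a \<otimes> s x"
      using decompose[OF gh(1)] .
    obtain b y where h: "b \<in> N" "y \<in> carrier K" "h = b \<otimes> s y"
      using decompose[OF gh(2)] .
    let ?n = "(s x \<star> b) \<otimes> inv (s y \<star> a)"
    have n: "?n \<in> N"
      using g h by simp
    have "g \<star> h = ?n \<otimes> s (x \<star>\<^bsub>K\<^esub> y)"
      using g h by (simp add: star_expand)
    then have "lift \<alpha> \<eta> (g \<star> h) = \<alpha> ?n \<otimes> s (\<eta> (x \<star>\<^bsub>K\<^esub> y))"
      using g h n by (simp only: lift_eq[OF c] K.star_closed)
    also have "\<dots> = ((s (\<eta> x) \<star> \<alpha> b) \<otimes> inv (s (\<eta> y) \<star> \<alpha> a)) \<otimes> (s (\<eta> x) \<star> s (\<eta> y))"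
      using g h by (simp add: compatibleD(3,4)[OF c])
    also have "\<dots> = (\<alpha> a \<otimes> s (\<eta> x)) \<star> (\<alpha> b \<otimes> s (\<eta> y))"
      using g h by (simp add: star_expand)
    finally show ?thesis
      using g h by (simp add: lift_eq[OF c])
  qed
  show "bij_betw (lift \<alpha> \<eta>) (carrier G) (carrier G)"
    unfolding bij_betw_def
  proof
    show "inj_on (lift \<alpha> \<eta>) (carrier G)"
    proof
      fix g h assume gh: "g \<in> carrier G" "h \<in> carrier G" and eq: "lift \<alpha> \<eta> g = lift \<alpha> \<eta> h"
      obtain a x where g: "a \<in> N" "x \<in> carrier K" "g = a \<otimes> s x"
        using decompose[OF gh(1)] .
      obtain b y where h: "b \<in> N" "y \<in> carrier K" "h = b \<otimes> s y"
        using decompose[OF gh(2)] .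
      have "\<eta> x = \<eta> y"
        using arg_cong[OF eq, of \<beta>] g h by (simp add: lift_eq[OF c])
      then have "x = y"
        using g h mla_autoD(2)[OF compatibleD(2)[OF c]] by (auto simp: bij_betw_def inj_on_def)
      moreover from this have "\<alpha> a = \<alpha> b"
        using eq g h by (simp add: lift_eq[OF c])
      then have "a = b"
        using g h mla_autoD(2)[OF compatibleD(1)[OF c]] by (auto simp: bij_betw_def inj_on_def)
      ultimately show "g = h"
        using g h by simp
    qed
    show "lift \<alpha> \<eta> ` carrier G = carrier G"
    proof
      show "lift \<alpha> \<eta> ` carrier G \<subseteq> carrier G"
      proof safe
        fix g assume "g \<in> carrier G"
        then obtain a x where g: "a \<in> N" "x \<in> carrier K" "g = a \<otimes> s x"
          by (rule decompose)
        then show "lift \<alpha> \<eta> g \<in> carrier G"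
          by (simp add: lift_eq[OF c])
      qed
      show "carrier G \<subseteq> lift \<alpha> \<eta> ` carrier G"
      proof
        fix g assume "g \<in> carrier G"
        then obtain a x where g: "a \<in> N" "x \<in> carrier K" "g = a \<otimes> s x"
          by (rule decompose)
        obtain a' where a': "a' \<in> N" "a = \<alpha> a'"
          using g(1) mla_autoD(2)[OF compatibleD(1)[OF c]] by (auto simp: bij_betw_def)
        obtain x' where x': "x' \<in> carrier K" "x = \<eta> x'"
          using g(2) mla_autoD(2)[OF compatibleD(2)[OF c]] by (auto simp: bij_betw_def)
        show "g \<in> lift \<alpha> \<eta> ` carrier G"
          using a' x' g lift_eq[OF c a'(1) x'(1)] by (intro image_eqI[of _ _ "a' \<otimes> s x'"]) auto
      qed
    qed
  qed
qed

lemma lift_compose: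
  assumes c: "compatible \<alpha> \<eta>" and d: "compatible \<alpha>' \<eta>'"
  shows "lift (compose N \<alpha> \<alpha>') (compose (carrier K) \<eta> \<eta>')
    = compose (carrier G) (lift \<alpha> \<eta>) (lift \<alpha>' \<eta>')"
proof (rule extensionalityI[of _ "carrier G"])
  fix g assume g: "g \<in> carrier G"
  let ?a = "g \<otimes> inv s (\<beta> g)"
  have a: "?a \<in> N"
    using g by (intro N_I) simp_all
  have "lift \<alpha> \<eta> (lift \<alpha>' \<eta>' g) = lift \<alpha> \<eta> (\<alpha>' ?a \<otimes> s (\<eta>' (\<beta> g)))"
    using g by (simp add: lift_def)
  also have "\<dots> = \<alpha> (\<alpha>' ?a) \<otimes> s (\<eta> (\<eta>' (\<beta> g)))"
    using g a mla_auto_N_simps(1)[OF compatibleD(1)[OF d]] mla_autoD(3)[OF compatibleD(2)[OF d]]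
    by (intro lift_eq[OF c]) auto
  finally show "lift (compose N \<alpha> \<alpha>') (compose (carrier K) \<eta> \<eta>') g
      = compose (carrier G) (lift \<alpha> \<eta>) (lift \<alpha>' \<eta>') g"
    using g a by (simp add: compose_eq) (simp add: lift_def compose_eq)
qed (simp_all add: lift_def)

lemma lift_in_Aut_sub:
  assumes "compatible \<alpha> \<eta>"
  shows "lift \<alpha> \<eta> \<in> carrier (Aut_sub G N)"
proof -
  have "lift \<alpha> \<eta> ` N = \<alpha> ` N"
    using lift_on_N[OF assms] by (simp cong: image_cong)
  also have "\<dots> = N"
    using mla_autoD(2)[OF compatibleD(1)[OF assms]] by (simp add: bij_betw_def)
  finally show ?thesis
    using lift_mla_auto[OF assms] by (simp add: Aut_sub_def)
qed

lemma Pi1_lift: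
  assumes "compatible \<alpha> \<eta>"
  shows "Pi1 N (lift \<alpha> \<eta>) = \<alpha>"
  unfolding Pi1_def
  by (rule extensionalityI[of _ N])
    (use lift_on_N[OF assms] mla_autoD(1)[OF compatibleD(1)[OF assms]] in auto)

lemma Pi2_lift:
  assumes "compatible \<alpha> \<eta>"
  shows "Pi2 K \<beta> t (lift \<alpha> \<eta>) = \<eta>"
  unfolding Pi2_def
  by (rule extensionalityI[of _ "carrier K"])
    (use proj_lift[OF assms] mla_autoD(1)[OF compatibleD(2)[OF assms]] in auto)


section \<open>Triviality of the obstruction classes\<close>

lemma quotient_of_coboundaries:
  assumes "p \<in> N" "q \<in> N" "r \<in> N" "p' \<in> N" "q' \<in> N" "r' \<in> N"
  shows "(p \<otimes> q \<otimes> inv r) \<otimes> inv (p' \<otimes> q' \<otimes> inv r')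
    = (p \<otimes> inv p') \<otimes> (q \<otimes> inv q') \<otimes> inv (r \<otimes> inv r')"
  using assms by (simp add: G.inv_mult_group G.m_assoc N_commute N_left_commute)

text \<open>The values by which \<open>t\<close> fails to be the homomorphic section. They lie in \<open>N\<close>, and the
  cocycles of \<open>t\<close> are the coboundary of this function.\<close>

definition defect :: "'k \<Rightarrow> 'g"
  where "defect x = t x \<otimes> inv s x"

lemma defect_in_N [simp]: "x \<in> carrier K \<Longrightarrow> defect x \<in> N"
  unfolding defect_def by (intro N_I) simp_all

lemma transversal_eq: "x \<in> carrier K \<Longrightarrow> t x = defect x \<otimes> s x"
  by (simp add: defect_def G.m_assoc)

lemma cocycle_f_eq:
  assumes "x \<in> carrier K" "y \<in> carrier K"
  shows "cocycle_f G K t x y = defect x \<otimes> defect y \<otimes> inv (defect (x \<otimes>\<^bsub>K\<^esub> y))"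
proof -
  have "t x \<otimes> t y = (defect x \<otimes> defect y) \<otimes> s (x \<otimes>\<^bsub>K\<^esub> y)"
    using assms by (simp add: transversal_eq G.m_assoc N_left_commute)
  moreover have "inv t (x \<otimes>\<^bsub>K\<^esub> y) = inv s (x \<otimes>\<^bsub>K\<^esub> y) \<otimes> inv defect (x \<otimes>\<^bsub>K\<^esub> y)"
    using assms by (simp add: transversal_eq G.inv_mult_group del: section_simps(2))
  ultimately show ?thesis
    using assms unfolding cocycle_f_def
    by (simp add: G.m_assoc G.inv_solve_left' del: section_simps(2))
       (simp add: G.m_assoc[symmetric] del: section_simps(2))
qed

lemma cocycle_h_eq:
  assumes "x \<in> carrier K" "y \<in> carrier K"
  shows "cocycle_h G K t x y
    = (s x \<star> defect y) \<otimes> inv (s y \<star> defect x) \<otimes> inv (defect (x \<star>\<^bsub>K\<^esub> y))"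
proof -
  have "t x \<star> t y = ((s x \<star> defect y) \<otimes> inv (s y \<star> defect x)) \<otimes> s (x \<star>\<^bsub>K\<^esub> y)"
    using assms by (simp add: transversal_eq star_expand)
  moreover have "inv t (x \<star>\<^bsub>K\<^esub> y) = inv s (x \<star>\<^bsub>K\<^esub> y) \<otimes> inv defect (x \<star>\<^bsub>K\<^esub> y)"
    using assms by (simp add: transversal_eq G.inv_mult_group del: section_simps(3))
  ultimately show ?thesis
    using assms unfolding cocycle_h_def
    by (simp add: G.m_assoc G.inv_solve_left' del: section_simps(3))
       (simp add: G.m_assoc[symmetric] del: section_simps(3))
qed

text \<open>In a split extension all obstructions vanish. Transporting the coboundary of the defect by
  \<open>\<alpha>\<close> and \<open>\<eta>\<close> gives again a coboundary for the same \<open>\<Gamma>\<close>, by compatibility; the quotient of the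
  two is the coboundary of the quotient.\<close>

lemma trivial_class_compatible:
  assumes c: "compatible \<alpha> \<eta>"
  shows "trivial_class G K N t
    (\<lambda>x y. cocycle_f G K t (\<eta> x) (\<eta> y) \<otimes> inv \<alpha> (cocycle_f G K t x y))
    (\<lambda>x y. cocycle_h G K t (\<eta> x) (\<eta> y) \<otimes> inv \<alpha> (cocycle_h G K t x y))"
  unfolding trivial_class_def
proof (intro bexI[of _ "\<lambda>x. defect (\<eta> x) \<otimes> inv \<alpha> (defect x)"] conjI ballI)
  note \<alpha> = mla_auto_N_simps[OF compatibleD(1)[OF c]]
  note \<eta> = mla_autoD(3-5)[OF compatibleD(2)[OF c]]
  note [simp] = \<alpha> \<eta>
  let ?l = "\<lambda>x. defect (\<eta> x) \<otimes> inv \<alpha> (defect x)"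
  show "?l \<in> carrier K \<rightarrow> N"
    by simp
  show "?l \<one>\<^bsub>K\<^esub> = \<one>"
    by (simp add: mla_auto_K_one[OF compatibleD(2)[OF c]] defect_def)
  fix x y assume xy [simp]: "x \<in> carrier K" "y \<in> carrier K"
  show "cocycle_f G K t (\<eta> x) (\<eta> y) \<otimes> inv \<alpha> (cocycle_f G K t x y)
      = ?l x \<otimes> ?l y \<otimes> inv ?l (x \<otimes>\<^bsub>K\<^esub> y)"
    by (simp add: cocycle_f_eq quotient_of_coboundaries)
  have "Gamma G t x (?l y) = (s (\<eta> x) \<star> defect (\<eta> y)) \<otimes> inv \<alpha> (s x \<star> defect y)"
    by (simp add: Gamma_eq star_mult_N star_inv_N compatibleD(3,4)[OF c])
  moreover have "Gamma G t y (inv ?l x)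
      = inv (s (\<eta> y) \<star> defect (\<eta> x)) \<otimes> inv \<alpha> (inv (s y \<star> defect x))"
    by (simp add: Gamma_eq star_mult_N star_inv_N compatibleD(3,4)[OF c] G.inv_mult_group
        N_commute)
  ultimately show "cocycle_h G K t (\<eta> x) (\<eta> y) \<otimes> inv \<alpha> (cocycle_h G K t x y)
      = Gamma G t x (?l y) \<otimes> Gamma G t y (inv ?l x) \<otimes> inv ?l (x \<star>\<^bsub>K\<^esub> y)"
    by (simp add: cocycle_h_eq quotient_of_coboundaries del: \<alpha>(4)) (simp add: cocycle_h_eq quotient_of_coboundaries)
qed


section \<open>Restriction to the kernel and the induced map on the quotient\<close>

lemma Aut_sub_simps [simp]:
  "carrier (Aut_sub G N) = {\<phi> \<in> mla_auto G. \<phi> ` N = N}"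
  "\<one>\<^bsub>Aut_sub G N\<^esub> = (\<lambda>g\<in>carrier G. g)"
  "\<lbrakk>\<phi> \<in> mla_auto G; \<psi> \<in> mla_auto G\<rbrakk> \<Longrightarrow> \<phi> \<otimes>\<^bsub>Aut_sub G N\<^esub> \<psi> = compose (carrier G) \<phi> \<psi>"
  "Aut_sub G N\<lparr>carrier := X\<rparr> = mla_AutoGroup G\<lparr>carrier := X\<rparr>"
  by (simp_all add: Aut_sub_def)

lemma group_Aut_sub: "group (Aut_sub G N)"
proof -
  have AG: "group (mla_AutoGroup G)"
    by (rule group_mla_AutoGroup) auto
  have "subgroup {\<phi> \<in> mla_auto G. \<phi> ` N = N} (mla_AutoGroup G)"
  proof (rule group.subgroupI[OF AG])
    have "(\<lambda>g\<in>carrier G. g) ` N = N"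
      by (auto simp: image_iff)
    then show "{\<phi> \<in> mla_auto G. \<phi> ` N = N} \<noteq> {}"
      using id_mla_auto[of G] by auto
  next
    fix \<phi> assume "\<phi> \<in> {\<phi> \<in> mla_auto G. \<phi> ` N = N}"
    then have \<phi>: "\<phi> \<in> mla_auto G" "\<phi> ` N = N"
      by auto
    have NG: "N \<subseteq> carrier G"
      by auto
    have "(\<lambda>g\<in>carrier G. inv_into (carrier G) \<phi> g) ` N = inv_into (carrier G) \<phi> ` N"
      by (simp cong: image_cong)
    also have "\<dots> = inv_into (carrier G) \<phi> ` \<phi> ` N"
      by (simp add: \<phi>)
    also have "\<dots> = N"
      using mla_autoD(2)[OF \<phi>(1)] NG by (simp add: bij_betw_def inv_into_image_cancel)
    finally show "inv\<^bsub>mla_AutoGroup G\<^esub> \<phi> \<in> {\<phi> \<in> mla_auto G. \<phi> ` N = N}"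
      using inv_mla_auto[OF \<phi>(1)] by (simp add: inv_mla_AutoGroup[OF \<phi>(1)])
  next
    fix \<phi> \<psi> assume "\<phi> \<in> {\<phi> \<in> mla_auto G. \<phi> ` N = N}" "\<psi> \<in> {\<phi> \<in> mla_auto G. \<phi> ` N = N}"
    then have \<phi>: "\<phi> \<in> mla_auto G" "\<phi> ` N = N" "\<psi> \<in> mla_auto G" "\<psi> ` N = N"
      by auto
    have "compose (carrier G) \<phi> \<psi> ` N = \<phi> ` \<psi> ` N"
      by (simp add: compose_eq image_image cong: image_cong)
    then show "\<phi> \<otimes>\<^bsub>mla_AutoGroup G\<^esub> \<psi> \<in> {\<phi> \<in> mla_auto G. \<phi> ` N = N}"
      using \<phi> by (simp add: compose_mla_auto)
  qed simp
  then show ?thesis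
    unfolding Aut_sub_def by (rule subgroup.subgroup_is_group[OF _ AG])
qed

lemma mult_inv_in_N_iff:
  "\<lbrakk>g \<in> carrier G; h \<in> carrier G\<rbrakk> \<Longrightarrow> g \<otimes> inv h \<in> N \<longleftrightarrow> \<beta> g = \<beta> h"
  unfolding N_iff by (simp add: K.inv_solve_right')

context
  fixes \<phi> assumes \<phi>: "\<phi> \<in> mla_auto G" "\<phi> ` N = N"
begin

lemma Aut_sub_closed:
  "g \<in> carrier G \<Longrightarrow> \<phi> g \<in> carrier G"
  "a \<in> N \<Longrightarrow> \<phi> a \<in> N"
  using \<phi> mla_autoD(3)[OF \<phi>(1)] by auto

text \<open>Since \<open>\<phi>\<close> preserves \<open>N\<close>, the induced map on \<open>K\<close> can be computed from any preimage, not only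
  from the one chosen by \<open>t\<close>.\<close>

lemma proj_Aut_sub:
  assumes g: "g \<in> carrier G"
  shows "\<beta> (\<phi> g) = Pi2 K \<beta> t \<phi> (\<beta> g)"
proof -
  note [simp] = Aut_sub_closed
  let ?a = "g \<otimes> inv t (\<beta> g)"
  have a: "?a \<in> N"
    using g by (simp add: mult_inv_in_N_iff)
  have "\<phi> (?a \<otimes> t (\<beta> g)) = \<phi> ?a \<otimes> \<phi> (t (\<beta> g))"
    using g by (intro mla_autoD(4)[OF \<phi>(1)]) auto
  moreover have "?a \<otimes> t (\<beta> g) = g"
    using g by (simp add: G.m_assoc)
  moreover have "\<phi> ?a \<in> N"
    using a by simp
  ultimately have "\<beta> (\<phi> g) = \<beta> (\<phi> ?a) \<otimes>\<^bsub>K\<^esub> \<beta> (\<phi> (t (\<beta> g)))" "\<phi> ?a \<in> N"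
    using g by auto
  then show ?thesis
    using g by (simp add: Pi2_def)
qed

lemma Pi1_mla_auto: "Pi1 N \<phi> \<in> mla_auto NG"
proof (rule mla_autoI)
  have "inj_on \<phi> N"
    using mla_autoD(2)[OF \<phi>(1)] by (rule inj_on_subset[OF bij_betw_imp_inj_on]) auto
  then show "bij_betw (Pi1 N \<phi>) (carrier NG) (carrier NG)"
    using \<phi>(2) by (simp add: Pi1_def bij_betw_def)
qed (use mla_autoD(4,5)[OF \<phi>(1)] in \<open>simp_all add: Pi1_def\<close>)

lemma Pi2_mla_auto: "Pi2 K \<beta> t \<phi> \<in> mla_auto K"
proof (rule mla_autoI)
  note [simp] = Aut_sub_closed
  let ?\<eta> = "Pi2 K \<beta> t \<phi>"
  show "?\<eta> \<in> extensional (carrier K)"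
    by (simp add: Pi2_def)
  show "?\<eta> (x \<otimes>\<^bsub>K\<^esub> y) = ?\<eta> x \<otimes>\<^bsub>K\<^esub> ?\<eta> y" if "x \<in> carrier K" "y \<in> carrier K" for x y
    using that proj_Aut_sub[of "t x \<otimes> t y"] mla_autoD(4)[OF \<phi>(1), of "t x" "t y"]
    by (simp add: proj_Aut_sub)
  show "?\<eta> (x \<star>\<^bsub>K\<^esub> y) = ?\<eta> x \<star>\<^bsub>K\<^esub> ?\<eta> y" if "x \<in> carrier K" "y \<in> carrier K" for x y
    using that proj_Aut_sub[of "t x \<star> t y"] mla_autoD(5)[OF \<phi>(1), of "t x" "t y"]
    by (simp add: proj_Aut_sub)
  show "bij_betw ?\<eta> (carrier K) (carrier K)"
    unfolding bij_betw_def
  proof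
    show "inj_on ?\<eta> (carrier K)"
    proof
      fix x y assume xy: "x \<in> carrier K" "y \<in> carrier K" and eq: "?\<eta> x = ?\<eta> y"
      (* The images differ by an element of N = \<phi>(N), hence t x and t y differ by one of N. *)
      have "\<phi> (t x) \<otimes> inv \<phi> (t y) \<in> N"
        using xy eq by (simp add: mult_inv_in_N_iff Pi2_def)
      then obtain n where n: "n \<in> N" "\<phi> (t x) \<otimes> inv \<phi> (t y) = \<phi> n"
        using \<phi>(2) by auto
      then have "\<phi> (t x) = \<phi> n \<otimes> \<phi> (t y)"
        using xy by (simp add: G.inv_solve_right')
      then have "\<phi> (t x) = \<phi> (n \<otimes> t y)"
        using xy n by (simp add: mla_autoD(4)[OF \<phi>(1)])
      then have "t x = n \<otimes> t y"
        using mla_autoD(2)[OF \<phi>(1)] xy n by (simp add: bij_betw_def inj_on_def)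
      then have "\<beta> (t x) = \<beta> (n \<otimes> t y)"
        by simp
      then show "x = y"
        using xy n by simp
    qed
    show "?\<eta> ` carrier K = carrier K"
    proof
      show "?\<eta> ` carrier K \<subseteq> carrier K"
        by (auto simp: Pi2_def)
      show "carrier K \<subseteq> ?\<eta> ` carrier K"
      proof
        fix y assume y: "y \<in> carrier K"
        then obtain g where g: "g \<in> carrier G" "t y = \<phi> g"
          using mla_autoD(2)[OF \<phi>(1)] by (metis bij_betw_def image_iff transversal_simps(1))
        then have "y = ?\<eta> (\<beta> g)"
          using y proj_Aut_sub[OF g(1)] by (metis transversal_simps(2))
        then show "y \<in> ?\<eta> ` carrier K"
          using g by simp
      qed
    qed
  qed
qed

text \<open>Applying \<open>\<phi>\<close> to \<open>s(x) \<star> a\<close>: the element \<open>\<phi>(s(x))\<close> lies over \<open>\<eta>(x)\<close>, so it acts on \<open>N\<close> as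
  \<open>s(\<eta>(x))\<close> does.\<close>

lemma Pi1_star:
  assumes "x \<in> carrier K" "a \<in> N"
  shows "Pi1 N \<phi> (s x \<star> a) = s (Pi2 K \<beta> t \<phi> x) \<star> Pi1 N \<phi> a"
proof -
  note [simp] = Aut_sub_closed
  have "\<phi> (s x \<star> a) = \<phi> (s x) \<star> \<phi> a"
    using assms by (intro mla_autoD(5)[OF \<phi>(1)]) auto
  also have "\<dots> = s (Pi2 K \<beta> t \<phi> x) \<star> \<phi> a"
    using assms mla_autoD(3)[OF Pi2_mla_auto]
    by (intro star_N_cong) (simp_all add: proj_Aut_sub)
  finally show ?thesis
    using assms by (simp add: Pi1_def)
qed

lemma compatible_Pi:
  assumes "\<And>x a. \<lbrakk>x \<in> carrier K; a \<in> N\<rbrakk> \<Longrightarrow> s (Pi2 K \<beta> t \<phi> x) \<star> a = s x \<star> a"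
  shows "compatible (Pi1 N \<phi>) (Pi2 K \<beta> t \<phi>)"
proof -
  have "Pi1 N \<phi> a \<in> N" if "a \<in> N" for a
    using that by (simp add: Pi1_def Aut_sub_closed)
  then show ?thesis
    unfolding compatible_def
    using Pi1_mla_auto Pi2_mla_auto mla_autoD(3)[OF Pi2_mla_auto] assms
    by (simp add: Gamma_eq Pi1_star)
qed

lemma Pi1_eq_id_iff: "Pi1 N \<phi> = (\<lambda>a\<in>N. a) \<longleftrightarrow> (\<forall>a\<in>N. \<phi> a = a)"
  by (auto simp: Pi1_def restrict_def fun_eq_iff)

lemma Pi2_eq_id_iff:
  "Pi2 K \<beta> t \<phi> = (\<lambda>x\<in>carrier K. x) \<longleftrightarrow> (\<forall>g\<in>carrier G. \<phi> g \<otimes> inv g \<in> N)"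
proof
  assume eq: "Pi2 K \<beta> t \<phi> = (\<lambda>x\<in>carrier K. x)"
  show "\<forall>g\<in>carrier G. \<phi> g \<otimes> inv g \<in> N"
    by (simp add: mult_inv_in_N_iff proj_Aut_sub eq Aut_sub_closed)
next
  assume "\<forall>g\<in>carrier G. \<phi> g \<otimes> inv g \<in> N"
  then have "\<phi> (t x) \<otimes> inv t x \<in> N" if "x \<in> carrier K" for x
    using that by simp
  then have "\<beta> (\<phi> (t x)) = x" if "x \<in> carrier K" for x
    using that mult_inv_in_N_iff[of "\<phi> (t x)" "t x"] Aut_sub_closed(1)[of "t x"] by simp
  then show "Pi2 K \<beta> t \<phi> = (\<lambda>x\<in>carrier K. x)"
    by (auto simp: Pi2_def restrict_def fun_eq_iff)
qed

end

lemma Pi1_hom: "Pi1 N \<in> hom (Aut_sub G N) (mla_AutoGroup NG)"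
proof (rule homI)
  fix \<phi> \<psi> assume "\<phi> \<in> carrier (Aut_sub G N)" "\<psi> \<in> carrier (Aut_sub G N)"
  then have \<phi>: "\<phi> \<in> mla_auto G" "\<phi> ` N = N" and \<psi>: "\<psi> \<in> mla_auto G" "\<psi> ` N = N"
    by auto
  have "Pi1 N (compose (carrier G) \<phi> \<psi>) = compose N (Pi1 N \<phi>) (Pi1 N \<psi>)"
    by (rule extensionalityI[of _ N]) (auto simp: Pi1_def compose_eq Aut_sub_closed[OF \<psi>])
  then show "Pi1 N (\<phi> \<otimes>\<^bsub>Aut_sub G N\<^esub> \<psi>) = Pi1 N \<phi> \<otimes>\<^bsub>mla_AutoGroup NG\<^esub> Pi1 N \<psi>"
    by (simp add: \<phi> \<psi> Pi1_mla_auto)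
qed (simp add: Pi1_mla_auto)

lemma Pi2_hom: "Pi2 K \<beta> t \<in> hom (Aut_sub G N) (mla_AutoGroup K)"
proof (rule homI)
  fix \<phi> \<psi> assume "\<phi> \<in> carrier (Aut_sub G N)" "\<psi> \<in> carrier (Aut_sub G N)"
  then have \<phi>: "\<phi> \<in> mla_auto G" "\<phi> ` N = N" and \<psi>: "\<psi> \<in> mla_auto G" "\<psi> ` N = N"
    by auto
  have "Pi2 K \<beta> t (compose (carrier G) \<phi> \<psi>) = compose (carrier K) (Pi2 K \<beta> t \<phi>) (Pi2 K \<beta> t \<psi>)"
  proof (rule extensionalityI[of _ "carrier K"])
    fix x assume x: "x \<in> carrier K"
    have "Pi2 K \<beta> t (compose (carrier G) \<phi> \<psi>) x = \<beta> (\<phi> (\<psi> (t x)))"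
      using x by (simp add: Pi2_def compose_eq)
    also have "\<dots> = Pi2 K \<beta> t \<phi> (\<beta> (\<psi> (t x)))"
      using x by (intro proj_Aut_sub[OF \<phi>] Aut_sub_closed(1)[OF \<psi>]) simp
    also have "\<beta> (\<psi> (t x)) = Pi2 K \<beta> t \<psi> x"
      using x by (simp add: Pi2_def)
    finally show "Pi2 K \<beta> t (compose (carrier G) \<phi> \<psi>) x
        = compose (carrier K) (Pi2 K \<beta> t \<phi>) (Pi2 K \<beta> t \<psi>) x"
      using x by (simp add: compose_eq)
  qed (auto simp: Pi2_def)
  then show "Pi2 K \<beta> t (\<phi> \<otimes>\<^bsub>Aut_sub G N\<^esub> \<psi>) = Pi2 K \<beta> t \<phi> \<otimes>\<^bsub>mla_AutoGroup K\<^esub> Pi2 K \<beta> t \<psi>"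
    by (simp add: \<phi> \<psi> Pi2_mla_auto)
qed (simp add: Pi2_mla_auto)

lemma carrier_Aut_fix:
  "carrier (Aut_fix G N) = {\<phi> \<in> carrier (Aut_sub G N). Pi1 N \<phi> = (\<lambda>a\<in>N. a)}"
proof -
  have "\<phi> ` N = N" if "\<forall>a\<in>N. \<phi> a = a" for \<phi>
    using image_cong[of N N \<phi> "\<lambda>a. a"] that by simp
  then show ?thesis
    by (auto simp: Aut_fix_def Pi1_eq_id_iff)
qed

lemma carrier_Aut_sub_quot:
  "carrier (Aut_sub_quot G N) =
    {\<phi> \<in> carrier (Aut_sub G N). Pi2 K \<beta> t \<phi> = (\<lambda>x\<in>carrier K. x)}"
  by (auto simp: Aut_sub_quot_def Pi2_eq_id_iff)

lemma carrier_Aut_fix_quot: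
  "carrier (Aut_fix_quot G N) = {\<phi> \<in> carrier (Aut_sub G N).
    Pi1 N \<phi> = (\<lambda>a\<in>N. a) \<and> Pi2 K \<beta> t \<phi> = (\<lambda>x\<in>carrier K. x)}"
  by (auto simp: Aut_fix_quot_def carrier_Aut_fix Pi2_eq_id_iff)


section \<open>The two sequences for center extensions\<close>

lemma id_Aut_N: "(\<lambda>a\<in>N. a) \<in> mla_auto NG"
  using id_mla_auto[of NG] by simp

lemma id_Aut_K: "(\<lambda>x\<in>carrier K. x) \<in> mla_auto K"
  by (rule id_mla_auto) auto

lemma cocycle_in_N [simp]:
  assumes "x \<in> carrier K" "y \<in> carrier K"
  shows "cocycle_f G K t x y \<in> N" "cocycle_h G K t x y \<in> N"
  using assms by (simp_all add: cocycle_f_eq cocycle_h_eq)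

lemma trivial_class_cong:
  assumes "\<And>x y. \<lbrakk>x \<in> carrier K; y \<in> carrier K\<rbrakk> \<Longrightarrow> u x y = u' x y"
    and "\<And>x y. \<lbrakk>x \<in> carrier K; y \<in> carrier K\<rbrakk> \<Longrightarrow> v x y = v' x y"
  shows "trivial_class G K N t u v \<longleftrightarrow> trivial_class G K N t u' v'"
  using assms by (simp add: trivial_class_def)

text \<open>Triviality of the class is a consequence of compatibility; the same holds for \<open>C2\<close> and
  \<open>C12\<close> below.\<close>

lemma carrier_C1: "carrier (C1 G K N t) = {\<alpha>. compatible \<alpha> (\<lambda>x\<in>carrier K. x)}"
proof -
  have "trivial_class G K N t
      (\<lambda>x y. cocycle_f G K t x y \<otimes> inv \<alpha> (cocycle_f G K t x y))
      (\<lambda>x y. cocycle_h G K t x y \<otimes> inv \<alpha> (cocycle_h G K t x y))"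
    if "compatible \<alpha> (\<lambda>x\<in>carrier K. x)" for \<alpha>
    using trivial_class_compatible[OF that]
    by (rule trivial_class_cong[THEN iffD1, rotated 2]) simp_all
  then show ?thesis
    by (auto simp: C1_def compatible_def id_Aut_K)
qed

lemma carrier_C2: "carrier (C2 G K N t) = {\<eta>. compatible (\<lambda>a\<in>N. a) \<eta>}"
proof -
  have "trivial_class G K N t
      (\<lambda>x y. cocycle_f G K t (\<eta> x) (\<eta> y) \<otimes> inv cocycle_f G K t x y)
      (\<lambda>x y. cocycle_h G K t (\<eta> x) (\<eta> y) \<otimes> inv cocycle_h G K t x y)"
    if "compatible (\<lambda>a\<in>N. a) \<eta>" for \<eta>
    using trivial_class_compatible[OF that]
    by (rule trivial_class_cong[THEN iffD1, rotated 2]) simp_all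
  moreover have "Gamma G t x a \<in> N" if "x \<in> carrier K" "a \<in> N" for x a
    using that by (simp add: Gamma_eq)
  ultimately show ?thesis
    by (auto simp: C2_def compatible_def id_Aut_N)
qed

lemma split_exact_Pi1:
  "short_exact (Aut_fix_quot G N) (Aut_sub_quot G N) (C1 G K N t) (\<lambda>\<phi>. \<phi>) (Pi1 N)
    \<and> group_split (Aut_sub_quot G N) (C1 G K N t) (Pi1 N)"
proof -
  let ?id = "\<lambda>x\<in>carrier K. x"
  interpret Pi2: group_hom "Aut_sub G N" "mla_AutoGroup K" "Pi2 K \<beta> t"
    by (intro group_hom.intro group_hom_axioms.intro group_Aut_sub group_Aut_K Pi2_hom)
  have sub: "subgroup (carrier (Aut_sub_quot G N)) (Aut_sub G N)"
    using Pi2.subgroup_kernel unfolding kernel_def carrier_Aut_sub_quot by simp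
  have id: "compose (carrier K) ?id ?id = ?id"
    by (auto simp: compose_def)
  have "short_exact (Aut_sub G N\<lparr>carrier := carrier (Aut_fix_quot G N)\<rparr>)
      (Aut_sub G N\<lparr>carrier := carrier (Aut_sub_quot G N)\<rparr>)
      (mla_AutoGroup NG\<lparr>carrier := carrier (C1 G K N t)\<rparr>) (\<lambda>\<phi>. \<phi>) (Pi1 N)
    \<and> group_split (Aut_sub G N\<lparr>carrier := carrier (Aut_sub_quot G N)\<rparr>)
      (mla_AutoGroup NG\<lparr>carrier := carrier (C1 G K N t)\<rparr>) (Pi1 N)"
  proof (rule split_short_exact_restrict[OF group_Aut_sub group_Aut_N Pi1_hom sub])
    show "carrier (Aut_fix_quot G N) =
        {\<phi> \<in> carrier (Aut_sub_quot G N). Pi1 N \<phi> = \<one>\<^bsub>mla_AutoGroup NG\<^esub>}"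
      by (auto simp: carrier_Aut_fix_quot carrier_Aut_sub_quot)
    show "Pi1 N ` carrier (Aut_sub_quot G N) \<subseteq> carrier (C1 G K N t)"
    proof safe
      fix \<phi> assume "\<phi> \<in> carrier (Aut_sub_quot G N)"
      then have \<phi>: "\<phi> \<in> mla_auto G" "\<phi> ` N = N" "Pi2 K \<beta> t \<phi> = ?id"
        by (auto simp: carrier_Aut_sub_quot)
      show "Pi1 N \<phi> \<in> carrier (C1 G K N t)"
        using compatible_Pi[OF \<phi>(1,2)] by (simp add: carrier_C1 \<phi>(3))
    qed
    show "carrier (C1 G K N t) \<subseteq> carrier (mla_AutoGroup NG)"
      by (auto simp: carrier_C1 compatibleD)
    show "(\<lambda>\<alpha>. lift \<alpha> ?id) \<in> carrier (C1 G K N t) \<rightarrow> carrier (Aut_sub_quot G N)"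
      using lift_in_Aut_sub Pi2_lift by (auto simp: carrier_C1 carrier_Aut_sub_quot)
    show "Pi1 N (lift \<alpha> ?id) = \<alpha>" if "\<alpha> \<in> carrier (C1 G K N t)" for \<alpha>
      using that by (simp add: carrier_C1 Pi1_lift)
    show "lift (\<alpha> \<otimes>\<^bsub>mla_AutoGroup NG\<^esub> \<alpha>') ?id = lift \<alpha> ?id \<otimes>\<^bsub>Aut_sub G N\<^esub> lift \<alpha>' ?id"
      if "\<alpha> \<in> carrier (C1 G K N t)" "\<alpha>' \<in> carrier (C1 G K N t)" for \<alpha> \<alpha>'
      using that lift_compose[of \<alpha> ?id \<alpha>' ?id]
      by (simp add: carrier_C1 lift_mla_auto compatibleD id)
  qed
  then show ?thesis
    by (simp add: Aut_fix_quot_def Aut_sub_quot_def C1_def)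
qed

lemma split_exact_Pi2:
  "short_exact (Aut_fix_quot G N) (Aut_fix G N) (C2 G K N t) (\<lambda>\<phi>. \<phi>) (Pi2 K \<beta> t)
    \<and> group_split (Aut_fix G N) (C2 G K N t) (Pi2 K \<beta> t)"
proof -
  let ?id = "\<lambda>a\<in>N. a"
  interpret Pi1: group_hom "Aut_sub G N" "mla_AutoGroup NG" "Pi1 N"
    by (intro group_hom.intro group_hom_axioms.intro group_Aut_sub group_Aut_N Pi1_hom)
  have sub: "subgroup (carrier (Aut_fix G N)) (Aut_sub G N)"
    using Pi1.subgroup_kernel unfolding kernel_def carrier_Aut_fix by simp
  have id: "compose N ?id ?id = ?id"
    by (auto simp: compose_def)
  have "short_exact (Aut_sub G N\<lparr>carrier := carrier (Aut_fix_quot G N)\<rparr>)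
      (Aut_sub G N\<lparr>carrier := carrier (Aut_fix G N)\<rparr>)
      (mla_AutoGroup K\<lparr>carrier := carrier (C2 G K N t)\<rparr>) (\<lambda>\<phi>. \<phi>) (Pi2 K \<beta> t)
    \<and> group_split (Aut_sub G N\<lparr>carrier := carrier (Aut_fix G N)\<rparr>)
      (mla_AutoGroup K\<lparr>carrier := carrier (C2 G K N t)\<rparr>) (Pi2 K \<beta> t)"
  proof (rule split_short_exact_restrict[OF group_Aut_sub group_Aut_K Pi2_hom sub])
    show "carrier (Aut_fix_quot G N) =
        {\<phi> \<in> carrier (Aut_fix G N). Pi2 K \<beta> t \<phi> = \<one>\<^bsub>mla_AutoGroup K\<^esub>}"
      by (auto simp: carrier_Aut_fix_quot carrier_Aut_fix)
    show "Pi2 K \<beta> t ` carrier (Aut_fix G N) \<subseteq> carrier (C2 G K N t)"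
    proof safe
      fix \<phi> assume "\<phi> \<in> carrier (Aut_fix G N)"
      then have \<phi>: "\<phi> \<in> mla_auto G" "\<phi> ` N = N" "Pi1 N \<phi> = ?id"
        by (auto simp: carrier_Aut_fix)
      have "s (Pi2 K \<beta> t \<phi> x) \<star> a = s x \<star> a" if "x \<in> carrier K" "a \<in> N" for x a
        using Pi1_star[OF \<phi>(1,2) that] that by (simp add: \<phi>(3))
      then show "Pi2 K \<beta> t \<phi> \<in> carrier (C2 G K N t)"
        using compatible_Pi[OF \<phi>(1,2)] by (simp add: carrier_C2 \<phi>(3))
    qed
    show "carrier (C2 G K N t) \<subseteq> carrier (mla_AutoGroup K)"
      by (auto simp: carrier_C2 compatibleD)
    show "lift ?id \<in> carrier (C2 G K N t) \<rightarrow> carrier (Aut_fix G N)"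
      using lift_in_Aut_sub Pi1_lift by (auto simp: carrier_C2 carrier_Aut_fix)
    show "Pi2 K \<beta> t (lift ?id \<eta>) = \<eta>" if "\<eta> \<in> carrier (C2 G K N t)" for \<eta>
      using that by (simp add: carrier_C2 Pi2_lift)
    show "lift ?id (\<eta> \<otimes>\<^bsub>mla_AutoGroup K\<^esub> \<eta>') = lift ?id \<eta> \<otimes>\<^bsub>Aut_sub G N\<^esub> lift ?id \<eta>'"
      if "\<eta> \<in> carrier (C2 G K N t)" "\<eta>' \<in> carrier (C2 G K N t)" for \<eta> \<eta>'
      using that lift_compose[of ?id \<eta> ?id \<eta>']
      by (simp add: carrier_C2 lift_mla_auto compatibleD id)
  qed
  then show ?thesis
    by (simp add: Aut_fix_quot_def Aut_fix_def C2_def)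
qed


section \<open>The sequence for central extensions\<close>

context
  assumes central: "N \<subseteq> lie_center G"
begin

lemma star_trivial:
  assumes "g \<in> carrier G" "a \<in> N"
  shows "a \<star> g = \<one>" "g \<star> a = \<one>"
proof -
  show ag: "a \<star> g = \<one>"
    using central assms by (auto simp: lie_center_def)
  show "g \<star> a = \<one>"
    using G.star_swap[of a g] assms ag by simp
qed

lemma compatible_central:
  "compatible \<alpha> \<eta> \<longleftrightarrow> \<alpha> \<in> mla_auto NG \<and> \<eta> \<in> mla_auto K"
proof -
  have "Gamma G t x a = \<one>" if "x \<in> carrier K" "a \<in> N" for x a
    using that by (simp add: Gamma_eq star_trivial)
  then show ?thesis
    using mla_auto_N_simps(1,3)[of \<alpha>] mla_autoD(3)[of \<eta> K] by (auto simp: compatible_def)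
qed

lemma C12_eq: "C12 G K N t = mla_AutoGroup NG \<times>\<times> mla_AutoGroup K"
proof -
  have "{(\<alpha>, \<eta>). \<alpha> \<in> mla_auto NG \<and> \<eta> \<in> mla_auto K \<and> trivial_class G K N t
      (\<lambda>x y. cocycle_f G K t (\<eta> x) (\<eta> y) \<otimes> inv \<alpha> (cocycle_f G K t x y))
      (\<lambda>x y. cocycle_h G K t (\<eta> x) (\<eta> y) \<otimes> inv \<alpha> (cocycle_h G K t x y))}
    = mla_auto NG \<times> mla_auto K"
    using trivial_class_compatible by (auto simp: compatible_central)
  then show ?thesis
    by (simp add: C12_def DirProd_def)
qed

text \<open>With trivial \<open>\<Gamma>\<close> the second cocycle condition says that star products are sent to the
  identity.\<close>

lemma Z1_carrier:
  "carrier (Z1 G K N t) = {\<nu> \<in> carrier K \<rightarrow>\<^sub>E N. \<forall>x\<in>carrier K. \<forall>y\<in>carrier K.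
    \<nu> (x \<otimes>\<^bsub>K\<^esub> y) = \<nu> x \<otimes> \<nu> y \<and> \<nu> (x \<star>\<^bsub>K\<^esub> y) = \<one>}"
proof -
  have "Gamma G t x (\<nu> y) \<otimes> Gamma G t y (inv \<nu> x) = \<one>"
    if "x \<in> carrier K" "y \<in> carrier K" "\<nu> \<in> carrier K \<rightarrow>\<^sub>E N" for x y \<nu>
  proof -
    have "\<nu> x \<in> N" "\<nu> y \<in> N"
      using that by auto
    then show ?thesis
      using that by (simp add: Gamma_eq star_trivial)
  qed
  then show ?thesis
    by (auto simp: Z1_def)
qed

lemma Z1_simps [simp]:
  "\<one>\<^bsub>Z1 G K N t\<^esub> = (\<lambda>x\<in>carrier K. \<one>)"
  "\<nu> \<otimes>\<^bsub>Z1 G K N t\<^esub> \<mu> = (\<lambda>x\<in>carrier K. \<nu> x \<otimes> \<mu> x)"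
  by (simp_all add: Z1_def)

lemma Z1_D:
  assumes "\<nu> \<in> carrier (Z1 G K N t)"
  shows "\<nu> \<in> extensional (carrier K)"
    "x \<in> carrier K \<Longrightarrow> \<nu> x \<in> N"
    "\<lbrakk>x \<in> carrier K; y \<in> carrier K\<rbrakk> \<Longrightarrow> \<nu> (x \<otimes>\<^bsub>K\<^esub> y) = \<nu> x \<otimes> \<nu> y"
    "\<lbrakk>x \<in> carrier K; y \<in> carrier K\<rbrakk> \<Longrightarrow> \<nu> (x \<star>\<^bsub>K\<^esub> y) = \<one>"
    "\<nu> \<one>\<^bsub>K\<^esub> = \<one>"
proof -
  show cl: "\<nu> x \<in> N" if "x \<in> carrier K" for x
    using assms that by (auto simp: Z1_carrier)
  show m: "\<nu> (x \<otimes>\<^bsub>K\<^esub> y) = \<nu> x \<otimes> \<nu> y" if "x \<in> carrier K" "y \<in> carrier K" for x y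
    using assms that by (auto simp: Z1_carrier)
  show "\<nu> \<one>\<^bsub>K\<^esub> = \<one>"
    using m[of "\<one>\<^bsub>K\<^esub>" "\<one>\<^bsub>K\<^esub>"] cl[of "\<one>\<^bsub>K\<^esub>"] by simp
qed (use assms in \<open>auto simp: Z1_carrier PiE_def\<close>)

lemma group_Z1: "group (Z1 G K N t)"
proof (rule groupI)
  fix \<nu> \<mu> assume nm: "\<nu> \<in> carrier (Z1 G K N t)" "\<mu> \<in> carrier (Z1 G K N t)"
  note [simp] = Z1_D[OF nm(1)] Z1_D[OF nm(2)]
  show "\<nu> \<otimes>\<^bsub>Z1 G K N t\<^esub> \<mu> \<in> carrier (Z1 G K N t)"
    by (simp add: Z1_carrier G.m_assoc N_left_commute)
next
  fix \<nu> assume nm: "\<nu> \<in> carrier (Z1 G K N t)"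
  note [simp] = Z1_D[OF nm]
  have "(\<lambda>x\<in>carrier K. inv \<nu> x) \<in> carrier (Z1 G K N t)"
    by (simp add: Z1_carrier G.inv_mult_group N_commute)
  moreover have "(\<lambda>x\<in>carrier K. inv \<nu> x) \<otimes>\<^bsub>Z1 G K N t\<^esub> \<nu> = \<one>\<^bsub>Z1 G K N t\<^esub>"
    by (auto simp: restrict_def fun_eq_iff)
  ultimately show "\<exists>\<mu>\<in>carrier (Z1 G K N t). \<mu> \<otimes>\<^bsub>Z1 G K N t\<^esub> \<nu> = \<one>\<^bsub>Z1 G K N t\<^esub>"
    by blast
  show "\<one>\<^bsub>Z1 G K N t\<^esub> \<otimes>\<^bsub>Z1 G K N t\<^esub> \<nu> = \<nu>"
    by (rule extensionalityI[of _ "carrier K"]) simp_all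
next
  fix \<nu> \<mu> \<kappa> assume nm: "\<nu> \<in> carrier (Z1 G K N t)" "\<mu> \<in> carrier (Z1 G K N t)"
    "\<kappa> \<in> carrier (Z1 G K N t)"
  show "\<nu> \<otimes>\<^bsub>Z1 G K N t\<^esub> \<mu> \<otimes>\<^bsub>Z1 G K N t\<^esub> \<kappa> = \<nu> \<otimes>\<^bsub>Z1 G K N t\<^esub> (\<mu> \<otimes>\<^bsub>Z1 G K N t\<^esub> \<kappa>)"
    by (rule extensionalityI[of _ "carrier K"])
      (simp_all add: Z1_D[OF nm(1)] Z1_D[OF nm(2)] Z1_D[OF nm(3)] G.m_assoc)
qed (simp add: Z1_carrier)

lemma Z1_to_Aut_eq:
  assumes "\<nu> \<in> carrier (Z1 G K N t)" "g \<in> carrier G"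
  shows "Z1_to_Aut G \<beta> t \<nu> g = g \<otimes> \<nu> (\<beta> g)"
  using assms Z1_D(2)[OF assms(1)]
  by (simp add: Z1_to_Aut_def G.m_assoc N_commute[of "\<nu> (\<beta> g)" "t (\<beta> g)"] G.inv_solve_left')
    (simp add: G.m_assoc[symmetric])

text \<open>Multiplying by values in \<open>N\<close> does not affect star products, because \<open>N\<close> is contained in the
  Lie center; and \<open>\<nu>\<close> kills star products, so \<open>g \<mapsto> g \<nu>(\<beta> g)\<close> respects both operations.\<close>

lemma Z1_to_Aut_in_Aut_fix_quot:
  assumes \<nu>: "\<nu> \<in> carrier (Z1 G K N t)"
  shows "Z1_to_Aut G \<beta> t \<nu> \<in> carrier (Aut_fix_quot G N)"
proof -
  let ?\<phi> = "Z1_to_Aut G \<beta> t \<nu>"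
  note [simp] = Z1_D[OF \<nu>] Z1_to_Aut_eq[OF \<nu>]
  have "?\<phi> \<in> mla_auto G"
  proof (rule mla_autoI)
    show "?\<phi> \<in> extensional (carrier G)"
      by (simp add: Z1_to_Aut_def)
    fix g h assume gh [simp]: "g \<in> carrier G" "h \<in> carrier G"
    show "?\<phi> (g \<otimes> h) = ?\<phi> g \<otimes> ?\<phi> h"
      by (simp add: G.m_assoc N_left_commute[of _ h])
    have "(g \<otimes> \<nu> (\<beta> g)) \<star> (h \<otimes> \<nu> (\<beta> h)) = g \<star> h"
      using star_expand[of "\<nu> (\<beta> g)" "\<nu> (\<beta> h)" g h] by (simp add: N_commute star_trivial)
    then show "?\<phi> (g \<star> h) = ?\<phi> g \<star> ?\<phi> h"
      by simp
  next
    show "bij_betw ?\<phi> (carrier G) (carrier G)"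
      unfolding bij_betw_def
    proof
      show "inj_on ?\<phi> (carrier G)"
      proof
        fix g h assume gh [simp]: "g \<in> carrier G" "h \<in> carrier G" and "?\<phi> g = ?\<phi> h"
        then have eq: "g \<otimes> \<nu> (\<beta> g) = h \<otimes> \<nu> (\<beta> h)"
          by simp
        have "\<beta> g = \<beta> h"
          using arg_cong[OF eq, of \<beta>] by simp
        then show "g = h"
          using eq by simp
      qed
      show "?\<phi> ` carrier G = carrier G"
      proof safe
        fix g assume g [simp]: "g \<in> carrier G"
        have "?\<phi> (g \<otimes> inv \<nu> (\<beta> g)) = g"
          by (simp add: G.m_assoc)
        then show "g \<in> ?\<phi> ` carrier G"
          by (intro image_eqI[of _ _ "g \<otimes> inv \<nu> (\<beta> g)"]) simp_all
      qed simp
    qed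
  qed
  then show ?thesis
    by (simp add: Aut_fix_quot_def Aut_fix_def mult_inv_in_N_iff)
qed

text \<open>The cocycle is read off on the section, \<open>\<nu>(x) = \<phi>(s(x)) s(x)\<inverse>\<close>. The section gives the same
  cocycle as \<open>t\<close>, since \<open>\<phi>\<close> fixes \<open>N\<close>, and the multiplicativity of \<open>s\<close> shortens the
  verification.\<close>

lemma Aut_fix_quot_in_Z1_image:
  assumes "\<phi> \<in> carrier (Aut_fix_quot G N)"
  shows "\<phi> \<in> Z1_to_Aut G \<beta> t ` carrier (Z1 G K N t)"
proof -
  have \<phi>: "\<phi> \<in> mla_auto G" and fixN [simp]: "\<And>a. a \<in> N \<Longrightarrow> \<phi> a = a"
    and diff: "\<And>g. g \<in> carrier G \<Longrightarrow> \<phi> g \<otimes> inv g \<in> N"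
    using assms by (auto simp: Aut_fix_quot_def Aut_fix_def)
  note [simp] = mla_autoD(3)[OF \<phi>]
  let ?\<nu> = "\<lambda>x\<in>carrier K. \<phi> (s x) \<otimes> inv s x"
  have \<nu>N [simp]: "\<phi> (s x) \<otimes> inv s x \<in> N" if "x \<in> carrier K" for x
    using that diff by simp
  have \<phi>s: "\<phi> (s x) = ?\<nu> x \<otimes> s x" if "x \<in> carrier K" for x
    using that by (simp add: G.m_assoc)
  have \<phi>_eq: "\<phi> g = g \<otimes> ?\<nu> (\<beta> g)" if "g \<in> carrier G" for g
  proof -
    obtain a x where g: "a \<in> N" "x \<in> carrier K" "g = a \<otimes> s x"
      using decompose[OF \<open>g \<in> carrier G\<close>] .
    have "\<phi> g = a \<otimes> (?\<nu> x \<otimes> s x)"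
      using g \<phi>s[of x] mla_autoD(4)[OF \<phi>, of a "s x"] by simp
    also have "\<dots> = a \<otimes> (s x \<otimes> ?\<nu> x)"
      using g N_commute[of "?\<nu> x" "s x"] by simp
    also have "\<dots> = g \<otimes> ?\<nu> (\<beta> g)"
      using g \<nu>N[OF g(2)] N_simps(1)[OF \<nu>N[OF g(2)]] by (simp only: proj_simps N_simps
          section_simps proj_section K.l_one restrict_apply' G.m_assoc)
    finally show ?thesis .
  qed
  have "?\<nu> \<in> carrier (Z1 G K N t)"
  proof -
    have "?\<nu> (x \<otimes>\<^bsub>K\<^esub> y) = ?\<nu> x \<otimes> ?\<nu> y" if xy: "x \<in> carrier K" "y \<in> carrier K" for x y
    proof -
      let ?a = "?\<nu> x" and ?b = "?\<nu> y"
      have ab: "?a \<in> N" "?b \<in> N"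
        using xy by simp_all
      have "\<phi> (s (x \<otimes>\<^bsub>K\<^esub> y)) = (?a \<otimes> s x) \<otimes> (?b \<otimes> s y)"
        using xy \<phi>s[OF xy(1)] \<phi>s[OF xy(2)] by (simp add: mla_autoD(4)[OF \<phi>])
      also have "\<dots> = (?a \<otimes> ?b) \<otimes> s (x \<otimes>\<^bsub>K\<^esub> y)"
        using xy ab N_simps(1)[OF ab(1)] N_simps(1)[OF ab(2)] N_left_commute[OF ab(2), of "s x" "s y"]
        by (simp only: section_simps G.m_assoc G.m_closed)
      finally show ?thesis
        using xy ab by (simp add: G.inv_solve_right' del: section_simps(2))
    qed
    moreover have "?\<nu> (x \<star>\<^bsub>K\<^esub> y) = \<one>" if xy: "x \<in> carrier K" "y \<in> carrier K" for x y
    proof -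
      let ?a = "?\<nu> x" and ?b = "?\<nu> y"
      have ab: "?a \<in> N" "?b \<in> N"
        using xy by simp_all
      have "\<phi> (s (x \<star>\<^bsub>K\<^esub> y)) = (?a \<otimes> s x) \<star> (?b \<otimes> s y)"
        using xy \<phi>s[OF xy(1)] \<phi>s[OF xy(2)] by (simp add: mla_autoD(5)[OF \<phi>])
      also have "\<dots> = s (x \<star>\<^bsub>K\<^esub> y)"
        using star_expand[OF ab, of "s x" "s y"] ab xy star_trivial(2)[OF _ ab(1), of "s y"]
          star_trivial(2)[OF _ ab(2), of "s x"] by simp
      finally show ?thesis
        using xy by (simp del: section_simps(3))
    qed
    ultimately show ?thesis
      unfolding Z1_carrier using \<nu>N by (simp del: section_simps)
  qed
  moreover have "\<phi> = Z1_to_Aut G \<beta> t ?\<nu>"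
  proof (rule extensionalityI[of _ "carrier G"])
    show "\<phi> g = Z1_to_Aut G \<beta> t ?\<nu> g" if "g \<in> carrier G" for g
      unfolding Z1_to_Aut_eq[OF \<open>?\<nu> \<in> carrier (Z1 G K N t)\<close> that] by (rule \<phi>_eq[OF that])
  qed (simp_all add: mla_autoD(1)[OF \<phi>] Z1_to_Aut_def)
  ultimately show ?thesis
    by blast
qed

lemma split_exact_Pi12:
  "short_exact (Z1 G K N t) (Aut_sub G N) (C12 G K N t) (Z1_to_Aut G \<beta> t) (Pi12 K N \<beta> t)
    \<and> group_split (Aut_sub G N) (C12 G K N t) (Pi12 K N \<beta> t)"
proof -
  let ?j = "Z1_to_Aut G \<beta> t"
  have into: "?j \<nu> \<in> mla_auto G" "?j \<nu> ` N = N" if "\<nu> \<in> carrier (Z1 G K N t)" for \<nu>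
    using Z1_to_Aut_in_Aut_fix_quot[OF that] by (simp_all add: carrier_Aut_fix_quot)
  have "?j (\<nu> \<otimes>\<^bsub>Z1 G K N t\<^esub> \<mu>) = ?j \<nu> \<otimes>\<^bsub>Aut_sub G N\<^esub> ?j \<mu>"
    if nm: "\<nu> \<in> carrier (Z1 G K N t)" "\<mu> \<in> carrier (Z1 G K N t)" for \<nu> \<mu>
  proof -
    have "?j (\<nu> \<otimes>\<^bsub>Z1 G K N t\<^esub> \<mu>) = compose (carrier G) (?j \<nu>) (?j \<mu>)"
    proof (rule extensionalityI[of _ "carrier G"])
      fix g assume g: "g \<in> carrier G"
      have cl: "\<nu> (\<beta> g) \<in> N" "\<mu> (\<beta> g) \<in> N"
        using g nm by (simp_all add: Z1_D)
      have "?j (\<nu> \<otimes>\<^bsub>Z1 G K N t\<^esub> \<mu>) g = g \<otimes> (\<nu> (\<beta> g) \<otimes> \<mu> (\<beta> g))"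
        using g Z1_to_Aut_eq[OF monoid.m_closed[OF group.is_monoid[OF group_Z1] nm] g] by simp
      also have "\<dots> = ?j \<nu> (?j \<mu> g)"
        using g cl N_commute[of "\<nu> (\<beta> g)" "\<mu> (\<beta> g)"]
        by (simp add: Z1_to_Aut_eq[OF nm(1)] Z1_to_Aut_eq[OF nm(2)] G.m_assoc)
      finally show "?j (\<nu> \<otimes>\<^bsub>Z1 G K N t\<^esub> \<mu>) g = compose (carrier G) (?j \<nu>) (?j \<mu>) g"
        using g by (simp add: compose_eq)
    qed (simp_all add: Z1_to_Aut_def)
    then show ?thesis
      using nm by (simp only: Aut_sub_simps(3) into)
  qed
  then have "?j \<in> hom (Z1 G K N t) (Aut_sub G N)"
    by (intro homI) (auto simp only: Aut_sub_simps(1) into mem_Collect_eq)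
  moreover have "inj_on ?j (carrier (Z1 G K N t))"
  proof
    fix \<nu> \<mu> assume nm: "\<nu> \<in> carrier (Z1 G K N t)" "\<mu> \<in> carrier (Z1 G K N t)"
      and eq: "?j \<nu> = ?j \<mu>"
    show "\<nu> = \<mu>"
    proof (rule extensionalityI[of _ "carrier K"])
      fix x assume x: "x \<in> carrier K"
      then show "\<nu> x = \<mu> x"
        using fun_cong[OF eq, of "s x"] Z1_D(2)[OF nm(1) x] Z1_D(2)[OF nm(2) x]
        by (simp add: Z1_to_Aut_eq[OF nm(1)] Z1_to_Aut_eq[OF nm(2)])
    qed (use nm in \<open>simp_all add: Z1_D(1)\<close>)
  qed
  ultimately have mon: "?j \<in> mon (Z1 G K N t) (Aut_sub G N)"
    by (simp add: mon_def)
  have p: "Pi12 K N \<beta> t \<in> hom (Aut_sub G N) (mla_AutoGroup NG \<times>\<times> mla_AutoGroup K)"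
    using Pi1_hom Pi2_hom by (auto simp: hom_def Pi12_def Pi_iff)
  have "kernel (Aut_sub G N) (mla_AutoGroup NG \<times>\<times> mla_AutoGroup K) (Pi12 K N \<beta> t)
      = carrier (Aut_fix_quot G N)"
    unfolding kernel_def carrier_Aut_fix_quot by (auto simp: Pi12_def)
  then have ker: "?j ` carrier (Z1 G K N t)
      = kernel (Aut_sub G N) (mla_AutoGroup NG \<times>\<times> mla_AutoGroup K) (Pi12 K N \<beta> t)"
    using Z1_to_Aut_in_Aut_fix_quot Aut_fix_quot_in_Z1_image by auto
  let ?\<delta> = "\<lambda>(\<alpha>, \<eta>). lift \<alpha> \<eta>"
  have \<delta>: "?\<delta> \<in> hom (mla_AutoGroup NG \<times>\<times> mla_AutoGroup K) (Aut_sub G N)"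
  proof (rule homI)
    fix c assume "c \<in> carrier (mla_AutoGroup NG \<times>\<times> mla_AutoGroup K)"
    then show "?\<delta> c \<in> carrier (Aut_sub G N)"
      using lift_in_Aut_sub compatible_central by auto
  next
    fix c d assume "c \<in> carrier (mla_AutoGroup NG \<times>\<times> mla_AutoGroup K)"
      "d \<in> carrier (mla_AutoGroup NG \<times>\<times> mla_AutoGroup K)"
    then show "?\<delta> (c \<otimes>\<^bsub>mla_AutoGroup NG \<times>\<times> mla_AutoGroup K\<^esub> d)
        = ?\<delta> c \<otimes>\<^bsub>Aut_sub G N\<^esub> ?\<delta> d"
      using compatible_central by (auto simp: lift_compose lift_mla_auto)
  qed
  show ?thesis
    unfolding C12_eq
  proof (rule split_short_exactI[OF group_Z1 group_Aut_sub _ mon p ker \<delta>])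
    show "group (mla_AutoGroup NG \<times>\<times> mla_AutoGroup K)"
      by (rule DirProd_group[OF group_Aut_N group_Aut_K])
    show "Pi12 K N \<beta> t (?\<delta> c) = c" if "c \<in> carrier (mla_AutoGroup NG \<times>\<times> mla_AutoGroup K)" for c
      using that compatible_central by (auto simp: Pi12_def Pi1_lift Pi2_lift)
  qed
qed

end

end


section \<open>Splitting of the automorphism sequences\<close>

theorem theorem4p1:
  fixes H :: "('h, 'l) mla_scheme" and G :: "('g, 'm) mla_scheme" and K :: "('k, 'n) mla_scheme"
    and \<iota> :: "'h \<Rightarrow> 'g" and \<beta> :: "'g \<Rightarrow> 'k" and t :: "'k \<Rightarrow> 'g" and N :: "'g set"
  assumes ext: "center_extension H \<iota> G \<beta> K"
    and N: "N = \<iota> ` carrier H"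
    and t: "transversal G \<beta> K t"
    and split: "extension_splits G \<beta> K"
  shows "(short_exact (Aut_fix_quot G N) (Aut_sub_quot G N) (C1 G K N t) (\<lambda>\<phi>. \<phi>) (Pi1 N)
        \<and> group_split (Aut_sub_quot G N) (C1 G K N t) (Pi1 N))
    \<and> (short_exact (Aut_fix_quot G N) (Aut_fix G N) (C2 G K N t) (\<lambda>\<phi>. \<phi>) (Pi2 K \<beta> t)
        \<and> group_split (Aut_fix G N) (C2 G K N t) (Pi2 K \<beta> t))
    \<and> (N \<subseteq> group_center G \<inter> lie_center G \<longrightarrow>
        short_exact (Z1 G K N t) (Aut_sub G N) (C12 G K N t) (Z1_to_Aut G \<beta> t) (Pi12 K N \<beta> t)
        \<and> group_split (Aut_sub G N) (C12 G K N t) (Pi12 K N \<beta> t))"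
proof -
  interpret E: center_extension H \<iota> G \<beta> K
    by (rule ext)
  obtain s where s: "transversal G \<beta> K s" "s \<in> mla_hom K G"
    using split by (auto simp: extension_splits_def)
  interpret S: split_center_extension G K \<beta> N s t
  proof
    show "N = kernel G K \<beta>"
      using E.exact by (simp add: N short_exact_def)
    show "a \<star>\<^bsub>G\<^esub> b = \<one>\<^bsub>G\<^esub>" if mem: "a \<in> N" "b \<in> N" for a b
    proof -
      obtain a' b' where ab: "a' \<in> carrier H" "a = \<iota> a'" "b' \<in> carrier H" "b = \<iota> b'"
        using mem N by auto
      have "a \<star>\<^bsub>G\<^esub> b = \<iota> (a' \<star>\<^bsub>H\<^esub> b')"
        using ab E.incl_hom by (simp add: mla_hom_def)
      also have "\<dots> = \<one>\<^bsub>G\<^esub>"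
        using ab E.incl_hom hom_one[OF _ E.H.is_group E.G.is_group, of \<iota>]
        by (simp add: E.star_trivial mla_hom_def)
      finally show ?thesis .
    qed
  qed (use E.proj_hom E.image_in_center N s t in \<open>auto simp: transversal_def\<close>)
  show ?thesis
    using S.split_exact_Pi1 S.split_exact_Pi2 S.split_exact_Pi12 by blast
qed

end
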